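(* The Fisher-Kolmogorov equation $$\frac{\partial u}{\partial t}=\frac{\partial^2 u}{\partial x^2}+u\,(1-u)$$ has algebraic traveling wave solutions only when the speed is $c=5/\sqrt{6}$, and they are $$u(x,t)=\frac{1}{\left(1+ k\, e^{\frac{1}{\sqrt 6}\left(x-\frac{5}{\sqrt{6}}t\right)}\right)^2},\qquad k>0.$$ That is, if $u$ is an algebraic traveling wave solution with speed $c$ of the Fisher-Kolmogorov equation $\frac{\partial u}{\partial t}=\frac{\partial^2 u}{\partial x^2}+u\,(1-u)$, then $c=5/\sqrt6$ and $u(x,t)=\left(1+ k\, e^{\frac{1}{\sqrt 6}\left(x-\frac{5}{\sqrt{6}}t\right)}\right)^{-2}$ for some $k>0$; and for each $k>0$ the function $u(x,t)=\left(1+ k\, e^{\frac{1}{\sqrt 6}\left(x-\frac{5}{\sqrt{6}}t\right)}\right)^{-2}$ is an algebraic traveling wave solution with speed $5/\sqrt6$.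
   Context: A traveling wave solution with speed $c\in\mathbb{R}$ of the Fisher-Kolmogorov equation $\frac{\partial u}{\partial t}=\frac{\partial^2 u}{\partial x^2}+u\,(1-u)$ is a solution of the form $u(x,t)=U(x-ct)$, where $U(s)$ is defined for all $s\in\mathbb{R}$, satisfies the ordinary differential equation $U''=-cU'-U(1-U)$, and satisfies the boundary conditions $\lim_{s\to-\infty}U(s)=1$ and $\lim_{s\to\infty}U(s)=0$. It is called algebraic if $U$ is non-constant and there exists a polynomial $p\in\mathbb{R}[z,w]$ (understood to be non-zero) such that $p(U(s),U'(s))=0$ for all $s\in\mathbb{R}$. *)

theory Defs
  imports "HOL-Analysis.Analysis" "HOL-Computational_Algebra.Polynomial"
begin

text \<open>
  Functions of position and time are curried as \<open>u x t\<close>. Solutions are classical: all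
  partial derivatives occurring in the equation are required to exist everywhere.
\<close>

definition fisher_kolmogorov_solution :: "(real \<Rightarrow> real \<Rightarrow> real) \<Rightarrow> bool" where
  "fisher_kolmogorov_solution u \<longleftrightarrow>
     (\<exists>u\<^sub>t u\<^sub>x u\<^sub>x\<^sub>x. \<forall>x t.
        ((\<lambda>\<tau>. u x \<tau>) has_real_derivative u\<^sub>t x t) (at t) \<and>
        ((\<lambda>\<xi>. u \<xi> t) has_real_derivative u\<^sub>x x t) (at x) \<and>
        ((\<lambda>\<xi>. u\<^sub>x \<xi> t) has_real_derivative u\<^sub>x\<^sub>x x t) (at x) \<and>
        u\<^sub>t x t = u\<^sub>x\<^sub>x x t + u x t * (1 - u x t))"

definition wave_profile :: "real \<Rightarrow> (real \<Rightarrow> real) \<Rightarrow> bool" where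
  "wave_profile c U \<longleftrightarrow>
     (\<forall>s. (U has_real_derivative deriv U s) (at s) \<and>
          (deriv U has_real_derivative (- c * deriv U s - U s * (1 - U s))) (at s)) \<and>
     (U \<longlongrightarrow> 1) at_bot \<and> (U \<longlongrightarrow> 0) at_top"

definition traveling_wave_with_profile ::
    "real \<Rightarrow> (real \<Rightarrow> real) \<Rightarrow> (real \<Rightarrow> real \<Rightarrow> real) \<Rightarrow> bool" where
  "traveling_wave_with_profile c U u \<longleftrightarrow>
     fisher_kolmogorov_solution u \<and> (\<forall>x t. u x t = U (x - c * t)) \<and> wave_profile c U"

text \<open>
  An element of \<open>\<real>[z,w]\<close> is represented in \<open>\<real>[z][w]\<close>: the inner variable is
  \<open>z\<close>, the outer one is \<open>w\<close>.
\<close>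

definition poly2 :: "real poly poly \<Rightarrow> real \<Rightarrow> real \<Rightarrow> real" where
  "poly2 p z w = poly (poly p [:w:]) z"

lemma poly2_altdef:
  "poly2 p z w = (\<Sum>j\<le>degree p. \<Sum>i\<le>degree (coeff p j). coeff (coeff p j) i * z ^ i * w ^ j)"
proof -
  have "poly2 p z w = (\<Sum>j\<le>degree p. poly (coeff p j) z * w ^ j)"
    by (simp add: poly2_def poly_altdef[of p] poly_sum)
  also have "\<dots> = (\<Sum>j\<le>degree p. \<Sum>i\<le>degree (coeff p j). coeff (coeff p j) i * z ^ i * w ^ j)"
    by (simp add: poly_altdef sum_distrib_right)
  finally show ?thesis .
qed

definition algebraic_profile :: "(real \<Rightarrow> real) \<Rightarrow> bool" where
  "algebraic_profile U \<longleftrightarrow>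
     \<not> U constant_on UNIV \<and>
     (\<exists>p :: real poly poly. p \<noteq> 0 \<and> (\<forall>s. poly2 p (U s) (deriv U s) = 0))"

definition algebraic_traveling_wave :: "real \<Rightarrow> (real \<Rightarrow> real \<Rightarrow> real) \<Rightarrow> bool" where
  "algebraic_traveling_wave c u \<longleftrightarrow>
     (\<exists>U. traveling_wave_with_profile c U u \<and> algebraic_profile U)"

end

theory Submission
  imports Defs "HOL-Computational_Algebra.Polynomial_Factorial"
    "HOL-Computational_Algebra.Field_as_Ring"
begin

text \<open>
  Write \<open>z = U\<close>, \<open>w = U'\<close>. The profile is an orbit of the planar system
  \<open>z' = w\<close>, \<open>w' = -c w - z (1 - z)\<close> that runs from the saddle \<open>(1,0)\<close> to \<open>(0,0)\<close>; the
  energy balance forces \<open>c > 0\<close>.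

  Let \<open>p\<close> be a primitive polynomial of minimal degree \<open>m\<close> in \<open>w\<close> that vanishes on the orbit.
  By pseudo-division and the Gauss lemma, the derivative \<open>X p\<close> of \<open>p\<close> along the vector field is
  a multiple \<open>K p\<close> (\<open>invariant_curve_exists\<close>). Give \<open>z\<close> weight 2 and \<open>w\<close> weight 3. The leading
  part \<open>w \<partial>\<^sub>z + z\<^sup>2 \<partial>\<^sub>w\<close> of \<open>X\<close> raises the weight by 1, so \<open>K\<close> is a constant \<open>k\<close>, and the top part
  of \<open>p\<close> is a first integral of it, a multiple of \<open>(w\<^sup>2 - 2/3 z\<^sup>3)\<^sup>n\<close>; in particular \<open>m = 2 n\<close>.
  Solvability for the part of the next lower weight forces \<open>k = -6 c n / 5\<close>
  (\<open>cofactor_value\<close>).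

  The degree is bounded by looking at the saddle. The variational equation along the orbit gives
  \<open>p\<^sub>w(U,U') = C exp((k + c) s) U'\<close>, where \<open>C \<noteq> 0\<close> by minimality. Since the left side is bounded at
  \<open>-\<infinity>\<close>, \<open>U'\<close> is \<open>O(exp(\<kappa> s))\<close> with \<open>\<kappa> = -(k + c) = c (6 n - 5) / 5\<close>. But \<open>1 - U\<close> cannot vanish
  faster than \<open>exp(\<lambda> s)\<close>, where \<open>\<lambda>\<close> is the positive eigenvalue of the saddle, so \<open>\<kappa> \<le> \<lambda>\<close>, which means
  \<open>\<kappa>\<^sup>2 + c \<kappa> \<le> 1\<close>, that is \<open>6 n (6 n - 5) c\<^sup>2 \<le> 25\<close> (\<open>decay_bound\<close>). If \<open>n \<ge> 2\<close>, then \<open>c < 2\<close>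
  and the orbit spirals into \<open>(0,0)\<close>: \<open>U\<close> has zeros arbitrarily far to the right
  (\<open>oscillates_below_speed_2\<close>), at which \<open>U'\<close> takes nonzero values tending to 0, all of them roots
  of the nonzero polynomial \<open>p(0,w)\<close>. This is impossible, so \<open>n = 1\<close>.

  For \<open>n = 1\<close> the coefficients of \<open>p\<close> can be computed: \<open>c\<^sup>2 = 25/6\<close>, and \<open>p = 0\<close> is the cuspidal cubic
  \<open>(3 w + \<surd>6 z)\<^sup>2 = 6 z\<^sup>3\<close> (\<open>quadratic_invariant_curve\<close>). It is rational, with parameter
  \<open>y = \<surd>6/2 (w/z) + 1\<close> and \<open>z = y\<^sup>2\<close>; on it the flow is \<open>y' = y (y - 1) / \<surd>6\<close>, which
  is affine in \<open>1/y\<close>.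
\<close>

section \<open>The Profile as an Orbit of a Planar System\<close>

lemma antimono_limit_at_bot_ge:
  fixes f :: "real \<Rightarrow> real"
  assumes "\<And>x. x \<le> b \<Longrightarrow> (f has_real_derivative f' x) (at x)"
    and "\<And>x. x \<le> b \<Longrightarrow> f' x \<le> 0" and "(f \<longlongrightarrow> l) at_bot" and "x \<le> b"
  shows "f x \<le> l"
proof (rule tendsto_lowerbound[OF assms(3)])
  have "f x \<le> f y" if "y \<le> x" for y
    using DERIV_nonpos_imp_nonincreasing[OF that] assms by (meson order_trans)
  then show "eventually (\<lambda>y. f x \<le> f y) at_bot"
    by (auto simp: eventually_at_bot_linorder)
qed simp

lemma exp_mult_at_bot:
  fixes a :: real
  assumes "a > 0"
  shows "((\<lambda>s. exp (a * s)) \<longlongrightarrow> 0) at_bot"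
  using assms
  by (auto intro!: filterlim_compose[OF exp_at_bot] filterlim_ident
      filterlim_tendsto_pos_mult_at_bot[OF tendsto_const])

text \<open>
  Over an interval of unit length \<open>f' + c f\<close> varies little because its derivative tends to 0, \<open>f\<close>
  varies little because it converges, and \<open>f'\<close> is small somewhere by the mean value theorem.
\<close>
lemma derivative_tendsto_0_at_top:
  fixes f :: "real \<Rightarrow> real"
  assumes f: "\<And>s. (f has_real_derivative f' s) (at s)"
    and f': "\<And>s. (f' has_real_derivative f'' s) (at s)"
    and lim: "(f \<longlongrightarrow> l) at_top"
    and h: "((\<lambda>s. f'' s + c * f' s) \<longlongrightarrow> 0) at_top"
  shows "(f' \<longlongrightarrow> 0) at_top"
proof (rule tendstoI)
  fix e :: real assume "e > 0"
  define d where "d = e / (4 + 2 * \<bar>c\<bar>)"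
  have den: "4 + 2 * \<bar>c\<bar> > 0" by simp
  have d: "d > 0" using \<open>e > 0\<close> den by (simp add: d_def)
  have e: "(4 + 2 * \<bar>c\<bar>) * d = e" using den by (simp add: d_def)
  obtain S where S: "\<And>s. s \<ge> S \<Longrightarrow> \<bar>f s - l\<bar> < d" "\<And>s. s \<ge> S \<Longrightarrow> \<bar>f'' s + c * f' s\<bar> < d"
    using eventually_conj[OF tendstoD[OF lim d] tendstoD[OF h d]]
    by (auto simp: eventually_at_top_linorder dist_real_def)
  have "\<bar>f' s\<bar> < e" if s: "s \<ge> S" for s
  proof -
    obtain x where x: "s < x" "x < s + 1" "f (s + 1) - f s = f' x"
      using MVT2[of s "s + 1" f f'] f by auto
    have "((\<lambda>y. f' y + c * f y) has_real_derivative f'' y + c * f' y) (at y)" for y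
      by (auto intro!: derivative_eq_intros f f')
    then obtain y where y: "s < y" "y < x"
        "(f' x + c * f x) - (f' s + c * f s) = (x - s) * (f'' y + c * f' y)"
      using MVT2[of s x "\<lambda>y. f' y + c * f y" "\<lambda>y. f'' y + c * f' y"] x by blast
    have 1: "\<bar>f' x\<bar> < 2 * d" using S(1)[of s] S(1)[of "s + 1"] s x(3) by linarith
    have "\<bar>f x - f s\<bar> \<le> 2 * d" using S(1)[of s] S(1)[of x] s x by linarith
    then have 2: "\<bar>c * (f x - f s)\<bar> \<le> \<bar>c\<bar> * (2 * d)" by (simp add: abs_mult mult_left_mono)
    have "\<bar>(x - s) * (f'' y + c * f' y)\<bar> \<le> 1 * d"
      unfolding abs_mult using S(2)[of y] s x y by (intro mult_mono) auto
    moreover have "f' s = f' x + c * (f x - f s) - (x - s) * (f'' y + c * f' y)"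
      using y(3) by (simp add: algebra_simps)
    ultimately have "\<bar>f' s\<bar> < 2 * d + \<bar>c\<bar> * (2 * d) + d" using 1 2 by linarith
    also have "\<dots> \<le> (4 + 2 * \<bar>c\<bar>) * d" using d by (simp add: algebra_simps)
    finally show ?thesis using e by simp
  qed
  then show "eventually (\<lambda>s. dist (f' s) 0 < e) at_top"
    by (auto simp: eventually_at_top_linorder dist_real_def)
qed

lemma derivative_tendsto_0_at_bot:
  fixes f :: "real \<Rightarrow> real"
  assumes f: "\<And>s. (f has_real_derivative f' s) (at s)"
    and f': "\<And>s. (f' has_real_derivative f'' s) (at s)"
    and lim: "(f \<longlongrightarrow> l) at_bot"
    and h: "((\<lambda>s. f'' s + c * f' s) \<longlongrightarrow> 0) at_bot"
  shows "(f' \<longlongrightarrow> 0) at_bot"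
proof -
  have "((\<lambda>s. - f' (- s)) \<longlongrightarrow> 0) at_top"
  proof (rule derivative_tendsto_0_at_top)
    show "((\<lambda>s. f (- s)) has_real_derivative - f' (- s)) (at s)" for s
      using f[of "- s"] by (simp add: DERIV_mirror)
    show "((\<lambda>s. - f' (- s)) has_real_derivative f'' (- s)) (at s)" for s
      using DERIV_minus[of "\<lambda>s. f' (- s)" "- f'' (- s)" s UNIV] f'[of "- s"] by (simp add: DERIV_mirror)
    show "((\<lambda>s. f (- s)) \<longlongrightarrow> l) at_top"
      using lim by (simp add: filterlim_at_bot_mirror)
    show "((\<lambda>s. f'' (- s) + (- c) * - f' (- s)) \<longlongrightarrow> 0) at_top"
      using h by (simp add: filterlim_at_bot_mirror)
  qed
  from tendsto_minus[OF this] show ?thesis by (simp add: filterlim_at_bot_mirror)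
qed

context
  fixes c :: real and U :: "real \<Rightarrow> real" and U' :: "real \<Rightarrow> real"
  assumes wave: "wave_profile c U"
  defines "U' \<equiv> deriv U"
begin

lemma U_deriv: "(U has_real_derivative U' s) (at s)"
  using wave by (simp add: wave_profile_def U'_def)

lemma U'_deriv: "(U' has_real_derivative - c * U' s - U s * (1 - U s)) (at s)"
  using wave by (simp add: wave_profile_def U'_def)

lemma U_at_bot: "(U \<longlongrightarrow> 1) at_bot" and U_at_top: "(U \<longlongrightarrow> 0) at_top"
  using wave by (simp_all add: wave_profile_def)

lemma U'_at_top: "(U' \<longlongrightarrow> 0) at_top"
proof (rule derivative_tendsto_0_at_top[OF U_deriv U'_deriv U_at_top])
  show "((\<lambda>s. - c * U' s - U s * (1 - U s) + c * U' s) \<longlongrightarrow> 0) at_top"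
    by (auto intro!: tendsto_eq_intros U_at_top)
qed

lemma U'_at_bot: "(U' \<longlongrightarrow> 0) at_bot"
proof (rule derivative_tendsto_0_at_bot[OF U_deriv U'_deriv U_at_bot])
  show "((\<lambda>s. - c * U' s - U s * (1 - U s) + c * U' s) \<longlongrightarrow> 0) at_bot"
    by (auto intro!: tendsto_eq_intros U_at_bot)
qed

text \<open>
  The energy \<open>U'\<^sup>2/2 + U\<^sup>2/2 - U\<^sup>3/3\<close> has derivative \<open>-c U'\<^sup>2\<close> and drops from \<open>1/6\<close> to \<open>0\<close>.
\<close>
lemma speed_pos: "c > 0"
proof (rule ccontr)
  assume "\<not> c > 0"
  define E where "E s = U' s ^ 2 / 2 + U s ^ 2 / 2 - U s ^ 3 / 3" for s
  have E': "(E has_real_derivative - c * U' s ^ 2) (at s)" for s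
    unfolding E_def
    by (auto intro!: derivative_eq_intros U_deriv U'_deriv)
       (simp add: field_simps power2_eq_square power3_eq_cube)
  have bot: "(E \<longlongrightarrow> 1 / 6) at_bot" unfolding E_def
    by (auto intro!: tendsto_eq_intros U_at_bot U'_at_bot)
  have top: "(E \<longlongrightarrow> 0) at_top" unfolding E_def
    by (auto intro!: tendsto_eq_intros U_at_top U'_at_top)
  have mono: "E x \<le> E y" if "x \<le> y" for x y
  proof (rule DERIV_nonneg_imp_nondecreasing[OF that])
    fix z show "\<exists>y. (E has_real_derivative y) (at z) \<and> 0 \<le> y"
      using E'[of z] \<open>\<not> c > 0\<close> by (meson mult_nonneg_nonneg neg_0_le_iff_le not_less zero_le_power2)
  qed
  have "E 0 \<ge> 1 / 6"
    by (rule tendsto_upperbound[OF bot]) (auto intro!: eventually_at_bot_linorderI mono)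
  moreover have "E 0 \<le> 0"
    by (rule tendsto_lowerbound[OF top]) (auto intro!: eventually_at_top_linorderI mono)
  ultimately show False by simp
qed

text \<open>
  The number \<open>l\<close> is the positive eigenvalue of the saddle \<open>(1,0)\<close>. With \<open>V = 1 - U\<close>, the difference
  \<open>D = V' - l V\<close> satisfies \<open>D' = -(c + l) D - V\<^sup>2\<close>: the nonlinearity has a sign, so the orbit stays
  on one side of the unstable direction.
\<close>
lemma unstable_direction_bound:
  assumes l: "l > 0" "l\<^sup>2 + c * l = 1"
  shows "- U' s \<le> l * (1 - U s)"
proof -
  define D where "D s = - U' s - l * (1 - U s)" for s
  have cl: "(c + l) * l = 1" using l(2) by (simp add: power2_eq_square algebra_simps)
  have D': "((\<lambda>s. D s * exp ((c + l) * s)) has_real_derivative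
      - ((1 - U s) ^ 2) * exp ((c + l) * s)) (at s)" for s
  proof -
    have "((\<lambda>s. D s * exp ((c + l) * s)) has_real_derivative
      (c * U' s + U s * (1 - U s) + l * U' s) * exp ((c + l) * s) 
        + D s * (exp ((c + l) * s) * (c + l))) (at s)"
      unfolding D_def by (auto intro!: derivative_eq_intros U_deriv U'_deriv)
    also have "(c * U' s + U s * (1 - U s) + l * U' s) * exp ((c + l) * s) 
        + D s * (exp ((c + l) * s) * (c + l)) = 
        (U s * (1 - U s) - ((c + l) * l) * (1 - U s)) * exp ((c + l) * s)"
      by (simp add: D_def algebra_simps)
    also have "\<dots> = - ((1 - U s) ^ 2) * exp ((c + l) * s)"
      unfolding cl by (simp add: algebra_simps power2_eq_square)
    finally show ?thesis .
  qed
  have "((\<lambda>s. exp ((c + l) * s)) \<longlongrightarrow> 0) at_bot"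
    using speed_pos l(1) by (intro exp_mult_at_bot) simp
  moreover have "(D \<longlongrightarrow> 0) at_bot"
    unfolding D_def by (auto intro!: tendsto_eq_intros U_at_bot U'_at_bot)
  ultimately have "((\<lambda>s. D s * exp ((c + l) * s)) \<longlongrightarrow> 0) at_bot"
    using tendsto_mult by fastforce
  from antimono_limit_at_bot_ge[OF D' _ this order_refl]
  have "D s * exp ((c + l) * s) \<le> 0" by simp
  then show ?thesis by (simp add: D_def mult_le_0_iff)
qed

text \<open>
  Hence \<open>1 - U\<close> cannot tend to 0 at \<open>-\<infinity>\<close> faster than \<open>exp (l s)\<close>.
\<close>
lemma distance_to_saddle_antimono:
  assumes l: "l > 0" "l\<^sup>2 + c * l = 1" and "x \<le> y"
  shows "(1 - U y) * exp (- l * y) \<le> (1 - U x) * exp (- l * x)"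
proof (rule DERIV_nonpos_imp_nonincreasing[OF \<open>x \<le> y\<close>])
  fix s
  have "((\<lambda>s. (1 - U s) * exp (- l * s)) has_real_derivative
      (- U' s - l * (1 - U s)) * exp (- l * s)) (at s)"
    by (auto intro!: derivative_eq_intros U_deriv simp: algebra_simps)
  then show "\<exists>y. ((\<lambda>s. (1 - U s) * exp (- l * s)) has_real_derivative y) (at s) \<and> y \<le> 0"
    using unstable_direction_bound[OF l, of s] by (meson diff_le_0_iff_le exp_ge_zero mult_nonpos_nonneg)
qed

lemma saddle_eigenvalue:
  obtains l where "l > 0" "l\<^sup>2 + c * l = 1"
proof
  let ?r = "sqrt (c\<^sup>2 + 4)"
  have "sqrt (c\<^sup>2) < ?r" by (subst real_sqrt_less_iff) simp
  then show "(?r - c) / 2 > 0" using speed_pos by simp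
  have "?r * ?r = c\<^sup>2 + 4" by simp
  then show "((?r - c) / 2)\<^sup>2 + c * ((?r - c) / 2) = 1"
    by (simp add: power2_eq_square field_simps)
qed

text \<open>
  If \<open>1 - U\<close> were nonpositive once, the same monotonicity would keep it nonpositive afterwards,
  against \<open>U \<longlongrightarrow> 0\<close>.
\<close>
lemma U_less_1: "U s < 1"
proof (rule ccontr)
  obtain l where l: "l > 0" "l\<^sup>2 + c * l = 1" by (rule saddle_eigenvalue)
  assume "\<not> U s < 1"
  then have "(1 - U s) * exp (- l * s) \<le> 0" by (simp add: mult_le_0_iff)
  then have "(1 - U y) * exp (- l * y) \<le> 0" if "s \<le> y" for y
    using distance_to_saddle_antimono[OF l that] by linarith
  then have "1 \<le> U y" if "s \<le> y" for y
    using that by (simp add: mult_le_0_iff)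
  then have "1 \<le> (0 :: real)"
    by (intro tendsto_lowerbound[OF U_at_top]) (auto intro!: eventually_at_top_linorderI)
  then show False by simp
qed

text \<open>
  With \<open>V = 1 - U\<close>, the product \<open>exp (c s) V V'\<close> has derivative \<open>exp (c s) (V'\<^sup>2 + V\<^sup>2 (1 - V))\<close>, which
  is positive while \<open>U > 0\<close>, and it starts from 0 at \<open>-\<infinity>\<close>.
\<close>
lemma eventually_decreasing:
  obtains S where "\<And>s. s \<le> S \<Longrightarrow> U s > 0" "\<And>s. s \<le> S \<Longrightarrow> U' s < 0"
proof -
  obtain S where S: "\<And>s. s \<le> S \<Longrightarrow> U s > 0"
    using order_tendstoD(1)[OF U_at_bot, of 0] by (auto simp: eventually_at_bot_linorder)
  define W where "W s = - (exp (c * s) * (1 - U s) * U' s)" for s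
  have W': "(W has_real_derivative exp (c * s) * (U' s ^ 2 + (1 - U s) ^ 2 * U s)) (at s)" for s
    unfolding W_def by (auto intro!: derivative_eq_intros U_deriv U'_deriv)
       (simp add: algebra_simps power2_eq_square)
  have "((\<lambda>s. exp (c * s)) \<longlongrightarrow> 0) at_bot"
    using speed_pos by (rule exp_mult_at_bot)
  moreover have "((\<lambda>s. (1 - U s) * U' s) \<longlongrightarrow> 0) at_bot"
    by (auto intro!: tendsto_eq_intros U_at_bot U'_at_bot)
  ultimately have "((\<lambda>s. - (exp (c * s) * ((1 - U s) * U' s))) \<longlongrightarrow> - (0 * 0)) at_bot"
    by (intro tendsto_minus tendsto_mult)
  then have lim: "(W \<longlongrightarrow> 0) at_bot"
    unfolding W_def by (simp add: mult.assoc)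
  have "U' s < 0" if s: "s \<le> S" for s
  proof -
    have "0 < W s"
    proof (rule DERIV_pos_imp_increasing_at_bot[OF _ lim])
      fix x assume "x \<le> s"
      then have "(1 - U x) ^ 2 * U x > 0" using S[of x] s U_less_1[of x] by simp
      then have "exp (c * x) * (U' x ^ 2 + (1 - U x) ^ 2 * U x) > 0"
        by (simp add: add_nonneg_pos)
      then show "\<exists>y. (W has_real_derivative y) (at x) \<and> 0 < y" using W' by blast
    qed
    then have "exp (c * s) * (1 - U s) * U' s < 0" by (simp add: W_def)
    moreover have "exp (c * s) * (1 - U s) > 0" using U_less_1[of s] by simp
    ultimately show ?thesis by (metis mult_less_0_iff not_less_iff_gr_or_eq)
  qed
  with S that show thesis by blast
qed

text \<open>
  This is backward uniqueness at the equilibrium \<open>(0,0)\<close>, by a Gronwall estimate for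
  \<open>U\<^sup>2 + U'\<^sup>2\<close>.
\<close>
lemma not_equilibrium:
  assumes "U s = 0" shows "U' s \<noteq> 0"
proof
  assume "U' s = 0"
  obtain S0 where S0: "\<And>s. s \<le> S0 \<Longrightarrow> U s > 0" by (metis eventually_decreasing)
  define S where "S = min S0 s"
  have "continuous_on {S..s} U"
    using U_deriv by (meson DERIV_isCont continuous_at_imp_continuous_on)
  then have "bounded (U ` {S..s})"
    by (intro compact_imp_bounded compact_continuous_image) auto
  then obtain B where B: "\<And>x. x \<in> {S..s} \<Longrightarrow> \<bar>U x\<bar> \<le> B"
    unfolding bounded_iff real_norm_def by (meson image_eqI)
  define K where "K = 2 * c + B"
  define E where "E x = (U x ^ 2 + U' x ^ 2) * exp (K * x)" for x
  have "E S \<le> E s"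
  proof (rule DERIV_nonneg_imp_nondecreasing[of S s E])
    show "S \<le> s" by (simp add: S_def)
    fix x assume x: "S \<le> x" "x \<le> s"
    have d: "(E has_real_derivative (- 2 * c * U' x ^ 2 + 2 * U x ^ 2 * U' x
        + K * (U x ^ 2 + U' x ^ 2)) * exp (K * x)) (at x)"
      unfolding E_def by (auto intro!: derivative_eq_intros U_deriv U'_deriv)
         (simp add: algebra_simps power2_eq_square)
    have "\<bar>2 * U x ^ 2 * U' x\<bar> = \<bar>U x\<bar> * (2 * \<bar>U x\<bar> * \<bar>U' x\<bar>)"
      by (simp add: abs_mult power2_eq_square)
    also have "\<dots> \<le> B * (U x ^ 2 + U' x ^ 2)"
      using B[of x] x sum_squares_bound[of "\<bar>U x\<bar>" "\<bar>U' x\<bar>"] by (intro mult_mono) auto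
    finally have "- 2 * c * U' x ^ 2 + 2 * U x ^ 2 * U' x + K * (U x ^ 2 + U' x ^ 2) \<ge> 2 * c * U x ^ 2"
      by (simp add: K_def algebra_simps)
    then have "0 \<le> (- 2 * c * U' x ^ 2 + 2 * U x ^ 2 * U' x + K * (U x ^ 2 + U' x ^ 2)) * exp (K * x)"
      using speed_pos by (meson exp_ge_zero less_imp_le mult_nonneg_nonneg order_trans zero_le_numeral zero_le_power2)
    with d show "\<exists>y. (E has_real_derivative y) (at x) \<and> 0 \<le> y" by blast
  qed
  then have "(U S ^ 2 + U' S ^ 2) * exp (K * S) \<le> 0"
    using \<open>U s = 0\<close> \<open>U' s = 0\<close> by (simp add: E_def)
  then have "U S ^ 2 + U' S ^ 2 \<le> 0" by (simp add: mult_le_0_iff)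
  then have "U S = 0" by (simp add: sum_power2_le_zero_iff)
  with S0[of S] show False by (simp add: S_def)
qed

text \<open>
  For \<open>c < 2\<close> the origin is a focus. If \<open>U\<close> had no more zeros, the ratio \<open>U'/U\<close> would exist forever and
  satisfy a Riccati equation whose right-hand side is at most \<open>-d (1 + y\<^sup>2)\<close> in the
  normalised variable \<open>y\<close>, so that \<open>arctan y\<close> would decrease at a rate of at least \<open>d\<close>.
\<close>
lemma oscillates_below_speed_2:
  assumes "c < 2"
  shows "\<exists>s\<ge>S. U s = 0"
proof (rule ccontr)
  assume "\<not> ?thesis"
  then have nz: "\<And>s. s \<ge> S \<Longrightarrow> U s \<noteq> 0" by blast
  \<comment> \<open>Completing the square leaves \<open>1 - c\<^sup>2/4 - U\<close>; \<open>d\<^sup>2\<close> is half of \<open>1 - c\<^sup>2/4\<close>, and the other half absorbs \<open>U\<close>.\<close>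
  define d where "d = sqrt ((1 - c\<^sup>2 / 4) / 2)"
  have "c\<^sup>2 < 2\<^sup>2" using assms speed_pos by (intro power_strict_mono) auto
  then have d2: "d\<^sup>2 = (1 - c\<^sup>2 / 4) / 2" and d: "d > 0" by (simp_all add: d_def)
  obtain S1 where S1: "\<And>s. s \<ge> S1 \<Longrightarrow> U s < d\<^sup>2"
    using order_tendstoD(2)[OF U_at_top, of "d\<^sup>2"] d by (auto simp: eventually_at_top_linorder)
  define T where "T = max S S1"
  define y where "y s = (U' s / U s + c / 2) / d" for s
  define f where "f s = arctan (y s) + d * s" for s
  \<comment> \<open>In time \<open>pi / d\<close> the arctangent would lose \<open>pi\<close>, the full length of its range.\<close>
  have "f (T + pi / d) \<le> f T"
  proof (rule DERIV_nonpos_imp_nonincreasing[of T "T + pi / d" f])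
    show "T \<le> T + pi / d" using d by simp
    fix x assume "T \<le> x"
    then have x: "U x \<noteq> 0" "U x < d\<^sup>2" using nz S1 by (auto simp: T_def)
    have "((\<lambda>s. U' s / U s) has_real_derivative
        ((- c * U' x - U x * (1 - U x)) * U x - U' x * U' x) / (U x * U x)) (at x)"
      using U_deriv U'_deriv x by (intro DERIV_divide) auto
    also have "((- c * U' x - U x * (1 - U x)) * U x - U' x * U' x) / (U x * U x)
        = - c * (U' x / U x) - (1 - U x) - (U' x / U x)\<^sup>2"
      using x by (simp add: field_simps power2_eq_square)
    finally have y': "(y has_real_derivative
        (- c * (U' x / U x) - (1 - U x) - (U' x / U x)\<^sup>2 + 0) / d) (at x)"
      unfolding y_def by (intro DERIV_cdivide DERIV_add DERIV_const)
    have square: "- c * R - (1 - U x) - R\<^sup>2 + 0 = - ((R + c / 2)\<^sup>2 + 2 * d\<^sup>2 - U x)" for R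
    proof -
      have "(R + c / 2)\<^sup>2 = R\<^sup>2 + c * R + c\<^sup>2 / 4"
        by (simp add: power2_sum power_divide)
      then show ?thesis unfolding d2 by (simp add: diff_divide_distrib)
    qed
    note y'
    also note square[of "U' x / U x"]
    also have "U' x / U x + c / 2 = y x * d" using d by (simp add: y_def)
    finally have y': "(y has_real_derivative - (y x ^ 2 * d\<^sup>2 + 2 * d\<^sup>2 - U x) / d) (at x)"
      by (simp only: power_mult_distrib)
    have f': "(f has_real_derivative inverse (1 + y x ^ 2) * (- (y x ^ 2 * d\<^sup>2 + 2 * d\<^sup>2 - U x) / d) + d) (at x)"
      unfolding f_def using y' by (auto intro!: derivative_eq_intros)
    define v where "v = 1 + y x ^ 2"
    have v: "v > 0" by (simp add: v_def add_pos_nonneg)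
    have "v * d\<^sup>2 \<le> y x ^ 2 * d\<^sup>2 + 2 * d\<^sup>2 - U x" using x by (simp add: v_def algebra_simps)
    then have "- (y x ^ 2 * d\<^sup>2 + 2 * d\<^sup>2 - U x) / d \<le> - (v * d\<^sup>2) / d"
      using d by (intro divide_right_mono) auto
    then have "inverse v * (- (y x ^ 2 * d\<^sup>2 + 2 * d\<^sup>2 - U x) / d) \<le> inverse v * (- (v * d\<^sup>2) / d)"
      using v by (intro mult_left_mono) auto
    also have "\<dots> = - d" using v d by (simp add: power2_eq_square)
    finally show "\<exists>z. (f has_real_derivative z) (at x) \<and> z \<le> 0"
      using f' by (intro exI conjI) (auto simp: v_def)
  qed
  then have "arctan (y (T + pi / d)) + pi \<le> arctan (y T)"
    using d by (simp add: f_def algebra_simps)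
  with arctan_ubound[of "y T"] arctan_lbound[of "y (T + pi / d)"] show False by simp
qed

end

section \<open>Polynomials along an Orbit\<close>

text \<open>
  The Lie derivative along the vector field \<open>w \<partial>\<^sub>z + (- c w - z (1 - z)) \<partial>\<^sub>w\<close>. In \<open>\<real>[z][w]\<close>, mapping
  \<^const>\<open>pderiv\<close> over the coefficients is \<open>\<partial>\<^sub>z\<close>, and \<^const>\<open>pderiv\<close> itself is \<open>\<partial>\<^sub>w\<close>.
\<close>
definition wave_lie :: "real \<Rightarrow> real poly poly \<Rightarrow> real poly poly" where
  "wave_lie c p = pCons 0 (map_poly pderiv p) + [:[:0, -1, 1:], [:- c:]:] * pderiv p"

lemma poly2_0 [simp]: "poly2 0 z w = 0"
  and poly2_pCons [simp]: "poly2 (pCons a p) z w = poly a z + w * poly2 p z w"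
  and poly2_add [simp]: "poly2 (p + q) z w = poly2 p z w + poly2 q z w"
  and poly2_mult [simp]: "poly2 (p * q) z w = poly2 p z w * poly2 q z w"
  and poly2_smult [simp]: "poly2 (smult a p) z w = poly a z * poly2 p z w"
  by (simp_all add: poly2_def)

lemma poly2_diff [simp]: "poly2 (p - q) z w = poly2 p z w - poly2 q z w"
  by (simp add: poly2_def)

lemma poly2_has_derivative:
  assumes "(f has_real_derivative f') (at s)" "(g has_real_derivative g') (at s)"
  shows "((\<lambda>s. poly2 p (f s) (g s)) has_real_derivative
    f' * poly2 (map_poly pderiv p) (f s) (g s) + g' * poly2 (pderiv p) (f s) (g s)) (at s)"
proof (induction p)
  case (pCons a p)
  have "((\<lambda>s. poly a (f s)) has_real_derivative poly (pderiv a) (f s) * f') (at s)"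
    by (rule DERIV_chain2[OF poly_DERIV assms(1)])
  from DERIV_add[OF this DERIV_mult[OF assms(2) pCons.IH]]
  show ?case by (simp add: map_poly_pCons pderiv_pCons algebra_simps)
qed simp

lemma tendsto_poly2:
  assumes "(f \<longlongrightarrow> a) F" "(g \<longlongrightarrow> b) F"
  shows "((\<lambda>s. poly2 p (f s) (g s)) \<longlongrightarrow> poly2 p a b) F"
  by (induction p) (auto intro!: tendsto_intros assms)

lemma poly2_wave_lie:
  "poly2 (wave_lie c p) z w =
     w * poly2 (map_poly pderiv p) z w + (- c * w - z * (1 - z)) * poly2 (pderiv p) z w"
  by (simp add: wave_lie_def algebra_simps)

text \<open>
  The commutator of \<open>\<partial>\<^sub>w\<close> with the vector field, which yields the variational equation for \<open>\<partial>\<^sub>w p\<close>.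
\<close>
lemma pderiv_wave_lie:
  "pderiv (wave_lie c p) = wave_lie c (pderiv p) + map_poly pderiv p - smult [:c:] (pderiv p)"
proof -
  have comm: "pderiv (map_poly pderiv p) = map_poly pderiv (pderiv p)"
    by (intro poly_eqI) (simp add: coeff_pderiv coeff_map_poly of_nat_poly pderiv_smult algebra_simps pderiv_mult)
  have neg: "[:- c:] = - [:c:]" by simp
  show ?thesis
    unfolding wave_lie_def neg
    by (simp add: pderiv_add pderiv_mult pderiv_pCons pderiv_smult pderiv_minus comm algebra_simps del: minus_pCons)
qed

lemma coeff_wave_lie:
  "coeff (wave_lie c p) j = (if j = 0 then 0 else pderiv (coeff p (j - 1)))
     - smult (c * real j) (coeff p j) + smult (real (j + 1)) ([:0, -1, 1:] * coeff p (j + 1))"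
proof -
  have s: "[:[:0, -1, 1:], [:- c:]:] * q = smult [:0, -1, 1:] q + pCons 0 (smult [:- c:] q)" for q :: "real poly poly"
    by simp
  have n: "of_nat k * (q :: real poly) = smult (real k) q" for k q
    by (simp add: of_nat_poly)
  have m: "[:x:] * (q :: real poly) = smult x q" for x q by simp
  show ?thesis unfolding wave_lie_def s
    by (cases j)
       (simp_all add: coeff_map_poly coeff_pderiv n m mult_smult_right mult.commute del: of_nat_Suc mult_pCons_left)
qed

lemma degree_wave_lie: "degree (wave_lie c p) \<le> Suc (degree p)"
  by (rule degree_le) (auto simp: coeff_wave_lie coeff_eq_0)

text \<open>
  By the Gauss lemma the pseudo-division factor \<open>a\<close> divides the content of the quotient and
  cancels.
\<close>
lemma pseudo_divisible_primitive:
  fixes p q s :: "real poly poly"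
  assumes "smult a q = p * s" "content p = 1" "a \<noteq> 0"
  obtains r where "q = p * r"
proof -
  have "normalize a * content q = content s"
    using arg_cong[OF assms(1), of content] assms(2) by (simp add: content_mult)
  then have "a dvd content s" by (metis dvd_triv_left normalize_dvd_iff)
  then have "[:a:] dvd s" by (simp add: const_poly_dvd_iff_dvd_content)
  then obtain r where "s = smult a r" by (auto elim!: dvdE)
  then have "smult a (q - p * r) = 0" using assms(1) by (simp add: smult_diff_right)
  then have "q = p * r" using assms(3) by simp
  then show thesis by (rule that)
qed

text \<open>
  The polynomial \<open>p\<close> is the primitive part of one of least degree in \<open>w\<close> that vanishes on the orbit
  segment. The remainder of \<open>wave_lie c p\<close> modulo \<open>p\<close> vanishes there too and has smaller degree, so
  it is 0; likewise \<open>\<partial>\<^sub>w p\<close> is too small to vanish. Injectivity of \<open>f\<close> makes a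
  nonzero polynomial in \<open>z\<close> alone vanish at finitely many times only, so that such factors can be
  cancelled by continuity.
\<close>
lemma invariant_curve_exists:
  fixes f g :: "real \<Rightarrow> real"
  assumes f: "\<And>s. s < S \<Longrightarrow> (f has_real_derivative g s) (at s)"
    and g: "\<And>s. s < S \<Longrightarrow> (g has_real_derivative - c * g s - f s * (1 - f s)) (at s)"
    and inj: "inj_on f {..<S}"
    and P: "P \<noteq> 0" "\<And>s. s < S \<Longrightarrow> poly2 P (f s) (g s) = 0"
  obtains p K where "wave_lie c p = p * K" "p \<noteq> 0" "degree p > 0"
    "\<And>s. s < S \<Longrightarrow> poly2 p (f s) (g s) = 0"
    "\<exists>s<S. poly2 (pderiv p) (f s) (g s) \<noteq> 0"
proof -
  define I where "I = {p. \<forall>s<S. poly2 p (f s) (g s) = 0}"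
  have fin: "finite {s. s < S \<and> poly a (f s) = 0}" if "a \<noteq> 0" for a
  proof -
    have "{s. s < S \<and> poly a (f s) = 0} = f -` {x. poly a x = 0} \<inter> {..<S}" by auto
    then show ?thesis using finite_vimage_IntI[OF poly_roots_finite[OF that] inj] by simp
  qed
  have cancel: "q \<in> I" if "smult a q \<in> I" "a \<noteq> 0" for a q
  proof -
    let ?h = "\<lambda>s. poly2 q (f s) (g s)"
    have "?h s = 0" if s: "s < S" for s
    proof -
      have "isCont ?h s"
        using poly2_has_derivative[OF f[OF s] g[OF s]] by (rule DERIV_isCont)
      then have lim: "(?h \<longlongrightarrow> ?h s) (at s)" by (simp add: isCont_def)
      have "eventually (\<lambda>t. t \<in> {..<S} - ({s. s < S \<and> poly a (f s) = 0} - {s})) (at s)"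
        using s fin[OF \<open>a \<noteq> 0\<close>]
        by (intro eventually_at_in_open' open_Diff finite_imp_closed) auto
      then have "eventually (\<lambda>t. ?h t = 0) (at s)"
      proof (rule eventually_mono[OF eventually_conj[OF _ eventually_neq_at_within[of s s UNIV]]], goal_cases)
        case (1 t)
        then have "t < S" "poly a (f t) \<noteq> 0" by auto
        then show ?case using \<open>smult a q \<in> I\<close> by (auto simp: I_def)
      qed
      then have "(?h \<longlongrightarrow> 0) (at s)" by (rule tendsto_eventually)
      with lim show ?thesis using LIM_unique by blast
    qed
    then show ?thesis by (simp add: I_def)
  qed
  obtain p0 where p0: "p0 \<in> I" "p0 \<noteq> 0" 
    and min0: "\<And>q. q \<in> I \<Longrightarrow> q \<noteq> 0 \<Longrightarrow> degree p0 \<le> degree q"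
    using ex_has_least_nat[of "\<lambda>p. p \<in> I \<and> p \<noteq> 0" P degree] P by (auto simp: I_def)
  define p where "p = primitive_part p0"
  have p: "p \<noteq> 0" "content p = 1" "degree p = degree p0" using p0 by (simp_all add: p_def)
  have min: "q = 0" if "q \<in> I" "degree q < degree p" for q
    using min0[of q] that p by force
  have pI: "p \<in> I"
    using cancel[of "content p0" p] p0 by (simp add: p_def)
  have deg: "degree p > 0"
  proof (rule ccontr)
    assume "\<not> degree p > 0"
    then obtain a where a: "p = [:a:]" by (auto elim: degree_eq_zeroE)
    then have "{s. s < S \<and> poly a (f s) = 0} = {..<S}" using pI by (auto simp: I_def)
    moreover have "a \<noteq> 0" using a p by auto
    ultimately show False using fin[of a] infinite_Iio by metis
  qed
  have lieI: "wave_lie c p \<in> I"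
    unfolding I_def
  proof safe
    fix s assume s: "s < S"
    have "((\<lambda>s. poly2 p (f s) (g s)) has_real_derivative poly2 (wave_lie c p) (f s) (g s)) (at s)"
      using poly2_has_derivative[OF f[OF s] g[OF s], of p] by (simp add: poly2_wave_lie algebra_simps)
    moreover have "((\<lambda>s. poly2 p (f s) (g s)) has_real_derivative 0) (at s)"
      by (rule has_field_derivative_transform_within_open[of "\<lambda>_. 0" 0 s "{..<S}"])
         (use s pI in \<open>auto simp: I_def\<close>)
    ultimately show "poly2 (wave_lie c p) (f s) (g s) = 0" by (rule DERIV_unique)
  qed
  obtain a q where aq: "a \<noteq> 0" "smult a (wave_lie c p) = p * q + pseudo_mod (wave_lie c p) p"
    using pseudo_mod(1)[OF p(1)] by blast
  have "pseudo_mod (wave_lie c p) p = smult a (wave_lie c p) - p * q" using aq by simp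
  then have "pseudo_mod (wave_lie c p) p \<in> I" using lieI pI by (simp add: I_def)
  then have "pseudo_mod (wave_lie c p) p = 0"
    using pseudo_mod(2)[OF p(1), of "wave_lie c p"] min by blast
  with aq have "smult a (wave_lie c p) = p * q" by simp
  then obtain K where K: "wave_lie c p = p * K"
    using pseudo_divisible_primitive p(2) aq(1) by metis
  have "pderiv p \<noteq> 0" using deg by (simp add: pderiv_eq_0_iff)
  then have "pderiv p \<notin> I" using min[of "pderiv p"] deg by (auto simp: degree_pderiv)
  then have "\<exists>s<S. poly2 (pderiv p) (f s) (g s) \<noteq> 0" by (simp add: I_def)
  then show thesis using that[OF K p(1) deg] pI by (simp add: I_def)
qed

section \<open>Invariant Algebraic Curves of the Wave System\<close>

text \<open>
  Applying the vector field raises the degree in \<open>w\<close> by at most 1, so \<open>K\<close> has degree at most 1 in \<open>w\<close>.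
  Comparison at degree \<open>m + 1\<close> in \<open>w\<close> says that the leading coefficient divides its own derivative.
\<close>
lemma cofactor_cases:
  assumes lie: "wave_lie c p = p * K" and p: "p \<noteq> 0"
  obtains K0 a where "K = [:K0:]" "a \<noteq> 0" "lead_coeff p = [:a:]"
proof -
  define K0 K1 where "K0 = coeff K 0" and "K1 = coeff K 1"
  have "degree K \<le> 1"
  proof (cases "K = 0")
    case False
    then have "degree p + degree K \<le> Suc (degree p)"
      using degree_wave_lie[of c p] p by (simp add: lie degree_mult_eq)
    then show ?thesis by simp
  qed simp
  then have K: "K = [:K0, K1:]"
    by (intro poly_eqI) (auto simp: K0_def K1_def coeff_pCons coeff_eq_0 split: nat.splits)
  have "coeff (p * K) (Suc (degree p)) = lead_coeff p * K1"
    by (simp add: K coeff_eq_0 mult.commute)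
  moreover have "coeff (wave_lie c p) (Suc (degree p)) = pderiv (lead_coeff p)"
    by (simp add: coeff_wave_lie coeff_eq_0)
  ultimately have eq: "pderiv (lead_coeff p) = lead_coeff p * K1" by (simp add: lie)
  have K1: "K1 = 0"
  proof (rule ccontr)
    assume "K1 \<noteq> 0"
    then have "degree (pderiv (lead_coeff p)) = degree (lead_coeff p) + degree K1"
      unfolding eq using p by (simp add: degree_mult_eq)
    then have "degree (lead_coeff p) = 0" by (simp add: degree_pderiv)
    then have "pderiv (lead_coeff p) = 0" by (simp add: pderiv_eq_0_iff)
    with eq \<open>K1 \<noteq> 0\<close> p show False by simp
  qed
  with eq have "degree (lead_coeff p) = 0" by (simp add: pderiv_eq_0_iff)
  then obtain a where a: "lead_coeff p = [:a:]" by (auto elim: degree_eq_zeroE)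
  moreover have "a \<noteq> 0" using a p by auto
  ultimately show thesis using that K K1 by simp
qed

text \<open>
  Coefficients counted from the top. The index is shifted by one, so that index 0 is the zero
  coefficient above the leading one; thus the two-step recursion below has no special first
  case.
\<close>
definition top_coeff :: "'a::zero poly \<Rightarrow> nat \<Rightarrow> 'a" where
  "top_coeff p i = (if i \<le> Suc (degree p) then coeff p (Suc (degree p) - i) else 0)"

lemma top_coeff_recursion:
  assumes lie: "wave_lie c p = p * [:K0:]" and i: "i \<le> degree p"
  shows "pderiv (top_coeff p (i + 2)) = (K0 + [:c * (real (degree p) - real i):]) * top_coeff p (i + 1)
    - smult (real (degree p) - real i + 1) ([:0, -1, 1:] * top_coeff p i)"
proof -
  define j where "j = degree p - i"
  have j: "degree p = i + j" using i by (simp add: j_def)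
  have 1: "(if j = 0 then 0 else pderiv (coeff p (j - 1))) = pderiv (top_coeff p (i + 2))"
    by (auto simp: top_coeff_def j)
  have 2: "coeff p j = top_coeff p (i + 1)" "coeff p (j + 1) = top_coeff p i"
    by (auto simp: top_coeff_def j)
  have "coeff (wave_lie c p) j = coeff (p * [:K0:]) j" by (simp only: lie)
  also have "coeff (p * [:K0:]) j = K0 * coeff p j" by simp
  finally have "pderiv (top_coeff p (i + 2)) - smult (c * real j) (top_coeff p (i + 1))
      + smult (real (j + 1)) ([:0, -1, 1:] * top_coeff p i) = K0 * top_coeff p (i + 1)"
    unfolding coeff_wave_lie 1 2 .
  moreover have "real (degree p) - real i = real j" by (simp add: j)
  ultimately show ?thesis
    by (simp add: distrib_right add.commute eq_diff_eq diff_add_eq)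
qed

lemma top_coeff_0 [simp]: "top_coeff p 0 = 0"
  and top_coeff_1: "top_coeff p 1 = lead_coeff p"
  and top_coeff_end: "top_coeff p (degree p + 2) = 0"
  by (simp_all add: top_coeff_def coeff_eq_0)

text \<open>
  If \<open>K0\<close> had degree \<open>d \<ge> 1\<close>, its term would dominate the recursion: every step would raise the
  degree by \<open>d + 1\<close>, and the coefficients would never run out.
\<close>
lemma cofactor_constant:
  assumes lie: "wave_lie c p = p * [:K0:]" and p: "p \<noteq> 0" and lead: "degree (lead_coeff p) = 0"
  shows "degree K0 = 0"
proof (rule ccontr)
  define d where "d = degree K0"
  assume "degree K0 \<noteq> 0"
  then have d: "d \<ge> 1" by (simp add: d_def)
  let ?b = "top_coeff p"
  have "?b (i + 1) \<noteq> 0 \<and> degree (?b (i + 1)) = i * (d + 1)" if "i \<le> degree p + 1" for i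
    using that
  proof (induction i rule: less_induct)
    case (less i)
    show ?case
    proof (cases i)
      case 0
      then show ?thesis using p lead by (simp add: top_coeff_1[simplified])
    next
      case (Suc j)
      define Kj where "Kj = K0 + [:c * (real (degree p) - real j):]"
      have Kj: "degree Kj = d" "Kj \<noteq> 0"
      proof -
        show "degree Kj = d" using d unfolding Kj_def d_def by (intro degree_add_eq_left) simp
        with d show "Kj \<noteq> 0" by auto
      qed
      have IH: "?b (j + 1) \<noteq> 0" "degree (?b (j + 1)) = j * (d + 1)"
        using less.IH[of j] less.prems Suc by auto
      have main: "degree (Kj * ?b (j + 1)) = d + j * (d + 1)"
        using IH Kj by (simp add: degree_mult_eq)
      define r where "r = smult (real (degree p) - real j + 1) ([:0, -1, 1:] * ?b j)"
      have "degree r < d + j * (d + 1)"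
      proof (cases j)
        case 0
        then show ?thesis using d by (simp add: r_def)
      next
        case (Suc l)
        have "degree r \<le> degree ([:0, -1, 1:] * ?b j)" unfolding r_def by (rule degree_smult_le)
        also have "\<dots> \<le> degree [:0, -1, 1 :: real:] + degree (?b j)" by (rule degree_mult_le)
        also have "degree (?b j) = l * (d + 1)"
          using less.IH[of l] less.prems \<open>i = Suc j\<close> Suc by auto
        finally show ?thesis using d Suc by simp
      qed
      then have "degree (Kj * ?b (j + 1) - r) = d + j * (d + 1)"
        using degree_add_eq_left[of "- r" "Kj * ?b (j + 1)"] main by simp
      moreover have "pderiv (?b (j + 2)) = Kj * ?b (j + 1) - r"
        unfolding Kj_def r_def using less.prems Suc by (intro top_coeff_recursion[OF lie]) simp
      ultimately have "degree (?b (j + 2)) - 1 = d + j * (d + 1)" by (metis degree_pderiv)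
      then have "degree (?b (i + 1)) = i * (d + 1)" "degree (?b (i + 1)) \<noteq> 0"
        using d Suc by auto
      then show ?thesis by auto
    qed
  qed
  from this[of "degree p + 1"] show False using top_coeff_end[of p] by simp
qed

lemma coeff_field_factor_mult:
  "coeff ([:0, -1, 1:] * (q :: real poly)) n =
     (if n \<ge> 2 then coeff q (n - 2) else 0) - (if n \<ge> 1 then coeff q (n - 1) else 0)"
  by (auto simp: coeff_pCons numeral_2_eq_2 split: nat.splits)

text \<open>
  With weight 2 for \<open>z\<close> and weight 3 for \<open>w\<close>, \<open>p\<close> has weight \<open>3 m\<close>. The coefficients \<open>A l\<close> of
  \<open>z\<^bsup>3 l\<^esup> w\<^bsup>m - 2 l\<^esup>\<close> have weight \<open>3 m\<close>, and the coefficients \<open>B l\<close> of \<open>z\<^bsup>3 l - 2\<^esup> w\<^bsup>m + 1 - 2 l\<^esup>\<close> have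
  weight \<open>3 m - 1\<close>. The recursion for \<open>A\<close> is that of \<open>(w\<^sup>2 - 2/3 z\<^sup>3)\<^bsup>m/2\<^esup>\<close> and terminates only for even
  \<open>m = 2 n\<close>. For \<open>k = -6 c n / 5\<close> the recursion for \<open>B\<close> is solved by the coefficients of
  \<open>(4 c n / 5) z w (w\<^sup>2 - 2/3 z\<^sup>3)\<^bsup>n - 1\<^esup>\<close>, which terminate as they must. For another \<open>k\<close> the deviation
  from this solution has the sign of \<open>k + 6 c n / 5\<close> in every step, up to the alternating sign of
  \<open>A\<close>, and so does not die out.
\<close>
lemma cofactor_value:
  assumes lie: "wave_lie c p = p * [:[:k:]:]" and p: "degree p > 0"
    and lead: "lead_coeff p = [:a:]" "a \<noteq> 0"
  obtains n where "degree p = 2 * n" "k = - 6 * c * real n / 5" "n \<ge> 1"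
proof -
  define m where "m = degree p"
  define b where "b i n = coeff (top_coeff p i) n" for i n
  have b0: "b 0 n = 0" for n by (simp add: b_def)
  have b1: "b 1 n = (if n = 0 then a else 0)" for n
    by (simp add: b_def top_coeff_1[simplified] lead coeff_pCons split: nat.splits)
  have b_end: "b (m + 2) n = 0" for n using top_coeff_end[of p] by (simp add: b_def m_def)
  have rec: "real (n + 1) * b (i + 2) (n + 1) = (k + c * (real m - real i)) * b (i + 1) n
      - (real m - real i + 1) * ((if n \<ge> 2 then b i (n - 2) else 0) - (if n \<ge> 1 then b i (n - 1) else 0))"
    if "i \<le> m" for i n
  proof -
    have "coeff (pderiv (top_coeff p (i + 2))) n = coeff
      (smult (k + c * (real m - real i)) (top_coeff p (i + 1))
        - smult (real m - real i + 1) ([:0, -1, 1:] * top_coeff p i)) n"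
      using top_coeff_recursion[OF lie, of i] that by (simp add: m_def)
    then show ?thesis
      unfolding coeff_pderiv coeff_diff coeff_smult coeff_field_factor_mult b_def by simp
  qed
  \<comment> \<open>No monomial of \<open>p\<close> has weight above \<open>3 m\<close>.\<close>
  have vanish: "b i n = 0" if "i \<le> m + 2" "3 * i < 2 * n + 3" for i n
    using that
  proof (induction i arbitrary: n rule: less_induct)
    case (less i)
    consider "i = 0" | "i = 1" | j where "i = j + 2" by (metis One_nat_def add_2_eq_Suc' not0_implies_Suc)
    then show ?case
    proof cases
      case 3
      with less.prems obtain l where l: "n = l + 1" by (cases n) auto
      have "b (j + 1) l = 0" using less.prems 3 l by (intro less.IH) auto
      moreover have "b j (l - 1) = 0" "b j (l - 2) = 0" using less.prems 3 l by (auto intro!: less.IH)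
      ultimately have "real (l + 1) * b (j + 2) (l + 1) = 0" using rec[of j l] less.prems 3 by simp
      then show ?thesis using 3 l by simp
    qed (use less.prems b0 b1[simplified] in auto)
  qed
  define A where "A l = b (2 * l + 1) (3 * l)" for l
  define B where "B l = b (2 * l) (3 * l - 2)" for l
  have A0: "A 0 = a" using b1[of 0] by (simp add: A_def)
  have B0: "B 0 = 0" using b0 by (simp add: B_def)
  have A_rec: "(3 * real l + 3) * A (l + 1) = - (real m - 2 * real l) * A l" if "2 * l + 1 \<le> m" for l
  proof -
    have "b (2 * l + 2) (3 * l + 2) = 0" "b (2 * l + 1) (3 * l + 1) = 0"
      using that by (auto intro!: vanish)
    then show ?thesis using rec[of "2 * l + 1" "3 * l + 2"] that
      by (simp add: A_def algebra_simps numeral_3_eq_3)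
  qed
  have B_rec: "(3 * real l + 1) * B (l + 1) = (k + c * (real m - 2 * real l)) * A l
      - (real m - 2 * real l + 1) * B l" if "2 * l \<le> m" for l
  proof -
    have "b (2 * l) (3 * l - 1) = 0" using that b0 by (cases "l = 0") (auto intro!: vanish)
    then show ?thesis using rec[of "2 * l" "3 * l"] that b0
      by (cases "l = 0") (auto simp: A_def B_def algebra_simps)
  qed
  have A_nz: "A l \<noteq> 0" if "2 * l \<le> m" for l
    using that
  proof (induction l)
    case (Suc l)
    then show ?case using A_rec[of l] by auto
  qed (simp add: A0 lead)
  show thesis
  proof (cases "even m")
    case False
    then obtain l where l: "m = 2 * l + 1" by (auto elim: oddE)
    have "A (l + 1) = 0" using b_end by (simp add: A_def l)
    then show thesis using A_rec[of l] A_nz[of l] by (simp add: l)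
  next
    case True
    then obtain n where n: "m = 2 * n" by (auto elim: evenE)
    define e where "e = k + 6 * c * real n / 5"
    \<comment> \<open>The term \<open>6 c l / 5\<close> is the explicit solution, \<open>e * r\<close> the deviation from it.\<close>
    have "\<exists>r\<ge>0. B l = - (6 * c * real l / 5 + e * r) * A l" if "l \<le> n" for l
      using that
    proof (induction l)
      case 0
      then show ?case by (auto simp: B0)
    next
      case (Suc l)
      then obtain r where r: "r \<ge> 0" "B l = - (6 * c * real l / 5 + e * r) * A l" by auto
      define N where "N = real n - real l"
      have N: "N > 0" using Suc by (simp add: N_def)
      define t where "t = (3 * real l + 3) / (2 * N)"
      have t: "t \<ge> 0" "t * N = (3 * real l + 3) / 2" using N by (simp_all add: t_def)
      define r' where "r' = (1 + (2 * N + 1) * r) * t / (3 * real l + 1)"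
      have "r' \<ge> 0" using r N t by (auto simp: r'_def)
      have r': "(3 * real l + 1) * r' = (1 + (2 * N + 1) * r) * t" by (simp add: r'_def)
      have A: "A l = - t * A (Suc l)"
        using A_rec[of l] Suc.prems N by (simp add: n N_def t_def field_simps)
      have "(3 * real l + 1) * B (Suc l) = (e * (1 + (2 * N + 1) * r) + (3 * real l + 1) * (4 * c / 5) * N) * A l"
      proof -
        define g where "g = c / 5"
        have g: "c = 5 * g" by (simp add: g_def)
        have "(3 * real l + 1) * B (Suc l) = (k + c * (2 * N)) * A l - (2 * N + 1) * B l"
          using B_rec[of l] Suc.prems by (simp add: n N_def)
        also have "k = e - 6 * g * (N + real l)" by (simp add: e_def g N_def)
        also have "B l = - (6 * g * real l + e * r) * A l" by (simp add: r(2) g)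
        also have "(e - 6 * g * (N + real l) + c * (2 * N)) * A l
            - (2 * N + 1) * (- (6 * g * real l + e * r) * A l)
          = (e * (1 + (2 * N + 1) * r) + (3 * real l + 1) * (4 * g) * N) * A l"
          unfolding g by algebra
        finally show ?thesis by (simp add: g)
      qed
      also have "\<dots> = (3 * real l + 1) * (- (6 * c * real (Suc l) / 5 + e * r') * A (Suc l))"
      proof -
        have "(e * (1 + (2 * N + 1) * r) + (3 * real l + 1) * (4 * c / 5) * N) * A l
          = - (e * ((1 + (2 * N + 1) * r) * t) + (3 * real l + 1) * (4 * c / 5) * (t * N)) * A (Suc l)"
          unfolding A by algebra
        also have "\<dots> = (3 * real l + 1) * (- (6 * c * real (Suc l) / 5 + e * r') * A (Suc l))"
          unfolding r'[symmetric] t(2) by (simp add: field_simps)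
        finally show ?thesis .
      qed
      finally have "B (Suc l) = - (6 * c * real (Suc l) / 5 + e * r') * A (Suc l)"
        by (simp add: mult_left_cancel)
      with \<open>r' \<ge> 0\<close> show ?case by blast
    qed
    then obtain r where r: "r \<ge> 0" "B n = - (6 * c * real n / 5 + e * r) * A n" by blast
    have "B (n + 1) = 0" using b_end by (simp add: B_def n)
    then have "k * A n = B n" using B_rec[of n] by (simp add: n)
    moreover define x where "x = 6 * c * real n / 5"
    moreover have "k = e - x" by (simp add: e_def x_def)
    ultimately have "(e - x) * A n = - (x + e * r) * A n" using r(2) by simp
    then have "e * (1 + r) * A n = 0" by algebra
    then have "e * (1 + r) = 0" using A_nz[of n] by (simp add: n)
    then have "e = 0" using r(1) by simp
    then show thesis using that[of n] n p by (simp add: e_def m_def)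
  qed
qed

lemma poly_of_pderiv:
  fixes q :: "real poly"
  assumes "pderiv q = [:x, y, z:]"
  shows "q = [:coeff q 0, x, y / 2, z / 3:]"
proof (rule poly_eqI)
  fix n
  show "coeff q n = coeff [:coeff q 0, x, y / 2, z / 3:] n"
  proof (cases n)
    case (Suc i)
    have "real (Suc i) * coeff q (Suc i) = coeff [:x, y, z:] i"
      using assms by (metis coeff_pderiv)
    then have "coeff q (Suc i) = coeff [:x, y, z:] i / real (Suc i)" by (simp add: field_simps)
    then show ?thesis unfolding Suc
      by (auto simp: coeff_pCons split: nat.splits)
  qed simp
qed

lemma quadratic_invariant_curve:
  assumes lie: "wave_lie c p = p * [:[:k:]:]" and deg: "degree p = 2"
    and lead: "lead_coeff p = [:a:]" "a \<noteq> 0" and k: "k = - 6 * c / 5" and c: "c > 0"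
  shows "c\<^sup>2 = 25 / 6"
    and "poly2 p z w = a * (w\<^sup>2 + 4 * c / 5 * z * w + 2 / 3 * z\<^sup>2 - 2 / 3 * z ^ 3)"
proof -
  define p0 p1 where "p0 = coeff p 0" and "p1 = coeff p 1"
  have p: "p = [:p0, p1, [:a:]:]"
    using lead deg by (intro poly_eqI)
      (auto simp: p0_def p1_def coeff_pCons numeral_2_eq_2 coeff_eq_0 split: nat.splits)
  have tc: "top_coeff p 1 = [:a:]" "top_coeff p 2 = p1" "top_coeff p 3 = p0" "top_coeff p 4 = 0"
    using deg lead by (simp_all add: top_coeff_def p0_def p1_def numeral_2_eq_2)
  note rec = top_coeff_recursion[OF lie, unfolded deg]
  have "pderiv p1 = [:(k + 2 * c) * a:]"
    using rec[of 0] tc by (simp add: numeral_2_eq_2)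
  then obtain e where p1: "p1 = [:e, (k + 2 * c) * a:]"
    using poly_of_pderiv[of p1 "(k + 2 * c) * a" 0 0, unfolded div_0 pCons_0_0] by blast
  have "pderiv p0 = [:(k + c) * e, (k + c) * ((k + 2 * c) * a) + 2 * a, - 2 * a:]"
  proof -
    have "pderiv p0 = ([:k:] + [:c:]) * p1 - smult 2 ([:0, -1, 1:] * [:a:])"
      using rec[of 1] tc by (simp add: numeral_3_eq_3 numeral_2_eq_2)
    then show ?thesis by (simp add: p1 algebra_simps)
  qed
  then obtain f where p0: "p0 = [:f, (k + c) * e, ((k + c) * ((k + 2 * c) * a) + 2 * a) / 2, - 2 * a / 3:]"
    using poly_of_pderiv by blast
  have "0 = smult k p0 - [:0, -1, 1:] * p1"
    using rec[of 2] tc by simp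
  then have eqs: "k * f = 0" "k * ((k + c) * e) + e = 0"
      "k * (((k + c) * ((k + 2 * c) * a) + 2 * a) / 2) - (e - (k + 2 * c) * a) = 0"
    unfolding p0 p1 by (simp_all add: algebra_simps)
  have "f = 0" using eqs(1) c k by simp
  define g where "g = c / 5"
  have g: "c = 5 * g" "k = - 6 * g" by (simp_all add: g_def k)
  have "(6 * g\<^sup>2 + 1) * e = 0" using eqs(2) unfolding g by algebra
  moreover have "6 * g\<^sup>2 + 1 > 0" by (simp add: add_nonneg_pos)
  ultimately have "e = 0" by simp
  have "2 * g * a * (6 * g\<^sup>2 - 1) = 0" using eqs(3) unfolding g \<open>e = 0\<close> by algebra
  then have g2: "g\<^sup>2 = 1 / 6" using lead c g by simp
  then show "c\<^sup>2 = 25 / 6" by (simp add: g power_mult_distrib)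
  have "((k + c) * ((k + 2 * c) * a) + 2 * a) / 2 = a * (1 - 2 * g\<^sup>2)"
    unfolding g by algebra
  also have "\<dots> = 2 / 3 * a" by (simp add: g2)
  finally have top: "((k + c) * ((k + 2 * c) * a) + 2 * a) / 2 = 2 / 3 * a" .
  have mid: "(k + 2 * c) * a = 4 * c / 5 * a" by (simp add: g)
  show "poly2 p z w = a * (w\<^sup>2 + 4 * c / 5 * z * w + 2 / 3 * z\<^sup>2 - 2 / 3 * z ^ 3)"
    unfolding p p0 p1 \<open>f = 0\<close> \<open>e = 0\<close> top unfolding mid
    by (simp add: power2_eq_square power3_eq_cube algebra_simps)
qed

section \<open>The Degree of the Invariant Curve and the Speed\<close>

context
  fixes c :: real and U :: "real \<Rightarrow> real"
  assumes wave: "wave_profile c U"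
begin

text \<open>
  Integrating the hypothesis gives \<open>1 - U = O(exp (\<kappa> s))\<close>, whereas \<open>1 - U\<close> is at least a
  constant times \<open>exp (l s)\<close>. So \<open>\<kappa> \<le> l\<close>, and \<open>x\<^sup>2 + c x\<close> increases up to its value 1 at \<open>l\<close>.
\<close>
lemma decay_bound:
  assumes \<kappa>: "\<kappa> > 0" and bound: "\<And>s. s \<le> S \<Longrightarrow> - deriv U s \<le> M * exp (\<kappa> * s)"
  shows "\<kappa>\<^sup>2 + c * \<kappa> \<le> 1"
proof -
  obtain l where l: "l > 0" "l\<^sup>2 + c * l = 1" by (rule saddle_eigenvalue[OF wave])
  have V: "1 - U s \<le> M / \<kappa> * exp (\<kappa> * s)" if "s \<le> S" for s
  proof -
    have 1: "((\<lambda>s. (1 - U s) - M / \<kappa> * exp (\<kappa> * s)) has_real_derivative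
        - deriv U s - M * exp (\<kappa> * s)) (at s)" for s
      using \<kappa> by (auto intro!: derivative_eq_intros U_deriv[OF wave])
    have "((\<lambda>s. exp (\<kappa> * s)) \<longlongrightarrow> 0) at_bot" using \<kappa> by (rule exp_mult_at_bot)
    then have "((\<lambda>s. (1 - U s) - M / \<kappa> * exp (\<kappa> * s)) \<longlongrightarrow> 1 - 1 - M / \<kappa> * 0) at_bot"
      by (intro tendsto_diff tendsto_mult tendsto_const U_at_bot[OF wave])
    then have "((\<lambda>s. (1 - U s) - M / \<kappa> * exp (\<kappa> * s)) \<longlongrightarrow> 0) at_bot" by simp
    from antimono_limit_at_bot_ge[OF 1 _ this that] bound show ?thesis by fastforce
  qed
  define a where "a = (1 - U S) * exp (- l * S)"
  have a: "a > 0" using U_less_1[OF wave, of S] by (simp add: a_def)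
  have le: "a \<le> M / \<kappa> * exp ((\<kappa> - l) * s)" if "s \<le> S" for s
  proof -
    have "a \<le> (1 - U s) * exp (- l * s)"
      unfolding a_def by (rule distance_to_saddle_antimono[OF wave l that])
    also have "\<dots> \<le> M / \<kappa> * exp (\<kappa> * s) * exp (- l * s)"
      using V[OF that] by (intro mult_right_mono) auto
    also have "\<dots> = M / \<kappa> * exp ((\<kappa> - l) * s)"
      by (simp add: mult_exp_exp algebra_simps)
    finally show ?thesis .
  qed
  have "\<kappa> \<le> l"
  proof (rule ccontr)
    assume "\<not> \<kappa> \<le> l"
    then have "((\<lambda>s. exp ((\<kappa> - l) * s)) \<longlongrightarrow> 0) at_bot"
      by (intro exp_mult_at_bot) simp
    then have "((\<lambda>s. M / \<kappa> * exp ((\<kappa> - l) * s)) \<longlongrightarrow> 0) at_bot" by (rule tendsto_mult_right_zero)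
    then have "a \<le> 0"
      by (rule tendsto_lowerbound[OF _ eventually_at_bot_linorderI[OF le]]) auto
    with a show False by simp
  qed
  then have "\<kappa>\<^sup>2 + c * \<kappa> \<le> l\<^sup>2 + c * l"
    using \<kappa> speed_pos[OF wave] by (intro add_mono power_mono mult_left_mono) auto
  with l show ?thesis by simp
qed

text \<open>
  The invariant curve has degree 2 in \<open>w\<close>: higher degrees \<open>2 n\<close> would make \<open>U'\<close> decay too fast at the
  saddle, unless \<open>c < 2\<close>, when the orbit is a spiral and lies on no algebraic curve.
\<close>
lemma algebraic_profile_curve:
  assumes P: "P \<noteq> 0" "\<And>s. poly2 P (U s) (deriv U s) = 0"
  shows "c\<^sup>2 = 25 / 6"
    and "(deriv U s)\<^sup>2 + 4 * c / 5 * U s * deriv U s + 2 / 3 * (U s)\<^sup>2 - 2 / 3 * U s ^ 3 = 0"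
proof -
  define W where "W = deriv U"
  note U' = U_deriv[OF wave, folded W_def] and W' = U'_deriv[OF wave, folded W_def]
  have c: "c > 0" by (rule speed_pos[OF wave])
  obtain S where S: "\<And>s. s \<le> S \<Longrightarrow> W s < 0"
    using eventually_decreasing[OF wave] unfolding W_def by metis
  have inj: "inj_on U {..<S}"
  proof (rule linorder_inj_onI)
    fix x y :: real assume xy: "x < y" "x \<in> {..<S}" "y \<in> {..<S}"
    have "U y < U x"
      using DERIV_neg_imp_decreasing[OF xy(1), of U] U' S xy
      by (meson lessThan_iff less_imp_le order_trans)
    then show "U x \<noteq> U y" by simp
  qed auto
  obtain p K where pK: "wave_lie c p = p * K" "p \<noteq> 0" "degree p > 0"
      and p0: "\<And>s. s < S \<Longrightarrow> poly2 p (U s) (W s) = 0"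
      and pw: "\<exists>s<S. poly2 (pderiv p) (U s) (W s) \<noteq> 0"
    using invariant_curve_exists[OF U' W' inj P(1)] P(2) unfolding W_def by blast
  obtain K0 a where K0: "K = [:K0:]" and a: "a \<noteq> 0" "lead_coeff p = [:a:]"
    using cofactor_cases[OF pK(1,2)] by metis
  have "degree K0 = 0" using cofactor_constant[OF pK(1)[unfolded K0] pK(2)] a by simp
  then obtain k where k: "K = [:[:k:]:]" using K0 by (metis degree_eq_zeroE)
  note lie = pK(1)[unfolded k]
  obtain n where n: "degree p = 2 * n" "k = - 6 * c * real n / 5" "n \<ge> 1"
    using cofactor_value[OF lie pK(3) a(2,1)] by metis
  have along: "((\<lambda>s. poly2 p (U s) (W s)) has_real_derivative k * poly2 p (U s) (W s)) (at s)" for s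
  proof -
    have "((\<lambda>s. poly2 p (U s) (W s)) has_real_derivative poly2 (wave_lie c p) (U s) (W s)) (at s)"
      using poly2_has_derivative[OF U' W', of p s] by (simp add: poly2_wave_lie algebra_simps)
    then show ?thesis by (simp add: lie mult.commute)
  qed
  \<comment> \<open>The linear equation for \<open>p(U,U')\<close> spreads its vanishing from \<open>s < S\<close> to the whole orbit.\<close>
  have zero: "poly2 p (U s) (W s) = 0" for s
  proof -
    have "((\<lambda>s. poly2 p (U s) (W s) * exp (- k * s)) has_real_derivative 0) (at s)" for s
      by (rule derivative_eq_intros along | simp)+
    then have "poly2 p (U s) (W s) * exp (- k * s) = poly2 p (U (S - 1)) (W (S - 1)) * exp (- k * (S - 1))"
      using DERIV_isconst_all[of "\<lambda>s. poly2 p (U s) (W s) * exp (- k * s)" s "S - 1"] by blast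
    then show ?thesis using p0[of "S - 1"] by simp
  qed
  define \<kappa> where "\<kappa> = - (k + c)"
  have \<kappa>: "\<kappa> = c * (6 * real n - 5) / 5" by (simp add: \<kappa>_def n(2) field_simps)
  have \<kappa>_pos: "\<kappa> > 0" using c n(3) by (simp add: \<kappa>)
  define G where "G s = poly2 (pderiv p) (U s) (W s)" for s
  define F where "F s = poly2 (map_poly pderiv p) (U s) (W s)" for s
  have tangent: "W s * F s + (- c * W s - U s * (1 - U s)) * G s = 0" for s
    using arg_cong[OF lie, of "\<lambda>q. poly2 q (U s) (W s)"] zero[of s]
    by (simp add: poly2_wave_lie F_def G_def)
  have G': "(G has_real_derivative - \<kappa> * G s - F s) (at s)" for s
  proof -
    have "(G has_real_derivative poly2 (wave_lie c (pderiv p)) (U s) (W s)) (at s)"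
      using poly2_has_derivative[OF U' W', of "pderiv p" s]
      unfolding G_def by (simp add: poly2_wave_lie algebra_simps)
    moreover have "wave_lie c (pderiv p) = pderiv (p * [:[:k:]:]) - map_poly pderiv p + smult [:c:] (pderiv p)"
      using pderiv_wave_lie[of c p] by (simp add: lie)
    ultimately show ?thesis
      by (simp add: pderiv_mult pderiv_pCons G_def F_def \<kappa>_def pderiv_smult algebra_simps)
  qed
  \<comment> \<open>By the variational equation \<open>G' + \<kappa> G = -F\<close> and the tangency relation, \<open>h\<close> is constant.\<close>
  define h where "h s = G s * exp (\<kappa> * s) / W s" for s
  have h': "(h has_real_derivative 0) (at s)" if "s < S" for s
  proof -
    have nz: "W s \<noteq> 0" using S[of s] that by simp
    have "((\<lambda>s. G s * exp (\<kappa> * s)) has_real_derivative - F s * exp (\<kappa> * s)) (at s)"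
      by (rule derivative_eq_intros G' refl | simp add: algebra_simps)+
    from DERIV_divide[OF this W' nz]
    have "(h has_real_derivative (- F s * exp (\<kappa> * s) * W s
        - G s * exp (\<kappa> * s) * (- c * W s - U s * (1 - U s))) / (W s * W s)) (at s)"
      unfolding h_def .
    also have "- F s * exp (\<kappa> * s) * W s - G s * exp (\<kappa> * s) * (- c * W s - U s * (1 - U s))
       = - exp (\<kappa> * s) * (W s * F s + (- c * W s - U s * (1 - U s)) * G s)"
      by (simp add: algebra_simps)
    finally show ?thesis by (simp only: tangent mult_zero_right div_0)
  qed
  obtain s0 where s0: "s0 < S" "G s0 \<noteq> 0" using pw by (auto simp: G_def)
  have h_const: "h s = h s0" if "s < S" for s
    using has_field_derivative_zero_constant[of "{..<S}" h] h' that s0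
    by (metis convex_real_interval(4) has_field_derivative_at_within lessThan_iff)
  have "h s0 \<noteq> 0" using s0 S[of s0] by (simp add: h_def)
  have "(G \<longlongrightarrow> poly2 (pderiv p) 1 0) at_bot"
    unfolding G_def W_def by (intro tendsto_poly2 U_at_bot[OF wave] U'_at_bot[OF wave])
  from tendstoD[OF this, of 1] obtain T where
    "\<And>s. s \<le> T \<Longrightarrow> \<bar>G s - poly2 (pderiv p) 1 0\<bar> < 1"
    by (auto simp: eventually_at_bot_linorder dist_real_def)
  then have G_bound: "\<bar>G s\<bar> \<le> 1 + \<bar>poly2 (pderiv p) 1 0\<bar>" if "s \<le> T" for s
    using that by fastforce
  define M where "M = (1 + \<bar>poly2 (pderiv p) 1 0\<bar>) / \<bar>h s0\<bar>"
  have "- W s \<le> M * exp (\<kappa> * s)" if s: "s \<le> min T (S - 1)" for s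
  proof -
    have "W s = G s * exp (\<kappa> * s) / h s0"
      using h_const[of s] s S[of s] \<open>h s0 \<noteq> 0\<close> by (simp add: h_def field_simps)
    then have "\<bar>W s\<bar> = \<bar>G s\<bar> / \<bar>h s0\<bar> * exp (\<kappa> * s)" by (simp add: abs_mult)
    also have "\<dots> \<le> M * exp (\<kappa> * s)"
      unfolding M_def using G_bound s by (intro mult_right_mono divide_right_mono) auto
    finally show ?thesis by simp
  qed
  from decay_bound[OF \<kappa>_pos this[unfolded W_def]] have "\<kappa>\<^sup>2 + c * \<kappa> \<le> 1" .
  also have "\<kappa>\<^sup>2 + c * \<kappa> = c\<^sup>2 * (6 * real n * (6 * real n - 5)) / 25"
    by (simp add: \<kappa> power2_eq_square field_simps)
  finally have c_le: "c\<^sup>2 * (6 * real n * (6 * real n - 5)) \<le> 25" by simp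
  have "n = 1"
  proof (rule ccontr)
    assume "n \<noteq> 1"
    then have "n \<ge> 2" using n(3) by simp
    \<comment> \<open>\<open>12\<close> and \<open>7\<close> are the values of \<open>6 n\<close> and \<open>6 n - 5\<close> at \<open>n = 2\<close>, and \<open>25 / 84 < 4\<close>.\<close>
    then have "12 * 7 \<le> 6 * real n * (6 * real n - 5)" by (intro mult_mono) auto
    then have "c\<^sup>2 * (12 * 7) \<le> c\<^sup>2 * (6 * real n * (6 * real n - 5))" by (intro mult_left_mono) auto
    with c_le have "c\<^sup>2 * (12 * 7) \<le> 25" by linarith
    then have "c\<^sup>2 < 2\<^sup>2" by simp
    then have "c < 2" by (rule power_less_imp_less_base) simp
    \<comment> \<open>\<open>q\<close> is \<open>p(0,w)\<close>; it is nonzero because the leading coefficient of \<open>p\<close> is a constant.\<close>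
    define q where "q = map_poly (\<lambda>a. poly a 0) p"
    have q: "poly q w = poly2 p 0 w" for w
      unfolding q_def by (induction p) (simp_all add: map_poly_pCons)
    have "coeff q (degree p) = a" using a by (simp add: q_def coeff_map_poly)
    then have "q \<noteq> 0" using a by auto
    define R where "R = {w. poly q w = 0} - {0}"
    have "closed R" using poly_roots_finite[OF \<open>q \<noteq> 0\<close>] by (simp add: R_def finite_imp_closed)
    then have "open (- R)" by (rule open_Compl)
    moreover have "0 \<in> - R" by (simp add: R_def)
    ultimately have "eventually (\<lambda>s. W s \<in> - R) at_top"
      using U'_at_top[OF wave] unfolding W_def by (rule topological_tendstoD[rotated])
    then obtain T where T: "\<And>s. s \<ge> T \<Longrightarrow> W s \<notin> R"
      by (auto simp: eventually_at_top_linorder)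
    obtain s where s: "s \<ge> T" "U s = 0"
      using oscillates_below_speed_2[OF wave \<open>c < 2\<close>] by blast
    have "W s \<noteq> 0" using not_equilibrium[OF wave s(2)] by (simp add: W_def)
    moreover have "poly q (W s) = 0" using zero[of s] s(2) by (simp add: q)
    ultimately show False using T[OF s(1)] by (simp add: R_def)
  qed
  with n have deg: "degree p = 2" and k1: "k = - 6 * c / 5" by simp_all
  show "c\<^sup>2 = 25 / 6" by (rule quadratic_invariant_curve(1)[OF lie deg a(2,1) k1 c])
  show "(deriv U s)\<^sup>2 + 4 * c / 5 * U s * deriv U s + 2 / 3 * (U s)\<^sup>2 - 2 / 3 * U s ^ 3 = 0"
    using quadratic_invariant_curve(2)[OF lie deg a(2,1) k1 c, of "U s" "W s"] zero[of s] a(1)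
    by (simp add: W_def)
qed

section \<open>Integration on the Curve\<close>

text \<open>
  The curve is \<open>(3 w + r z)\<^sup>2 = 6 z\<^sup>3\<close> with \<open>r = \<surd>6\<close>. The slope of the line through its cusp gives
  the parameter \<open>y\<close> with \<open>z = y\<^sup>2\<close>; both signs of the square root are thus treated
  together. Along the orbit \<open>1/y - 1\<close> is a multiple of \<open>exp (s / r)\<close>.
\<close>
lemma algebraic_profile_explicit:
  assumes P: "P \<noteq> 0" "\<And>s. poly2 P (U s) (deriv U s) = 0"
  shows "c = 5 / sqrt 6" and "\<exists>k>0. \<forall>s. U s = 1 / (1 + k * exp (1 / sqrt 6 * s)) ^ 2"
proof -
  define W where "W = deriv U"
  note U' = U_deriv[OF wave, folded W_def] and W' = U'_deriv[OF wave, folded W_def]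
  have c0: "c > 0" by (rule speed_pos[OF wave])
  have "c\<^sup>2 = (5 / sqrt 6)\<^sup>2" using algebraic_profile_curve(1)[OF P] by (simp add: power_divide)
  then show c: "c = 5 / sqrt 6" using c0 by (simp add: power2_eq_iff_nonneg)
  define r where "r = sqrt 6"
  have r: "r > 0" "r * r = 6" by (simp_all add: r_def)
  have "5 / r = 5 * r / (r * r)" using r(1) by simp
  then have cr: "c = 5 * r / 6" unfolding r(2) using c by (simp add: r_def)
  have curve: "(W s)\<^sup>2 + 2 * r / 3 * U s * W s + 2 / 3 * (U s)\<^sup>2 = 2 / 3 * U s ^ 3" for s
    using algebraic_profile_curve(2)[OF P, of s] by (simp add: cr W_def)
  have square: "(3 * W s + r * U s)\<^sup>2 = 6 * U s ^ 3" for s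
  proof -
    have "(3 * W s + r * U s)\<^sup>2 = 9 * ((W s)\<^sup>2 + 2 * r / 3 * U s * W s) + (r * r) * (U s)\<^sup>2"
      by (simp add: power2_eq_square algebra_simps)
    also have "\<dots> = 9 * ((W s)\<^sup>2 + 2 * r / 3 * U s * W s + 2 / 3 * (U s)\<^sup>2)"
      by (simp add: r)
    finally show ?thesis unfolding curve by simp
  qed
  have U_pos: "U s > 0" for s
  proof -
    have "U s ^ 3 \<ge> 0" using square[of s] by (metis mult_le_cancel_left_pos mult_zero_right zero_le_power2 zero_less_numeral)
    then have "U s \<ge> 0" by (simp add: zero_le_power_eq_numeral)
    moreover have "U s \<noteq> 0"
    proof
      assume "U s = 0"
      then have "W s = 0" using square[of s] by simp
      with not_equilibrium[OF wave \<open>U s = 0\<close>] show False by (simp add: W_def)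
    qed
    ultimately show ?thesis by simp
  qed
  define y where "y s = r / 2 * (W s / U s) + 1" for s
  have W_y: "W s / U s = r / 3 * (y s - 1)" for s
  proof -
    have "r / 3 * (y s - 1) = (r * r) / 6 * (W s / U s)" by (simp add: y_def mult.assoc)
    then show ?thesis unfolding r(2) by simp
  qed
  have y2: "(y s)\<^sup>2 = U s" for s
  proof -
    have "y s = r / (6 * U s) * (3 * W s + r * U s)"
    proof -
      have "r / (6 * U s) * (3 * W s + r * U s) = r / 2 * (W s / U s) + (r * r) / 6"
        using U_pos[of s] by (simp add: field_simps)
      also have "\<dots> = y s" unfolding r(2) y_def by simp
      finally show ?thesis by (rule sym)
    qed
    then have "(y s)\<^sup>2 = (r * r) / (36 * (U s)\<^sup>2) * (3 * W s + r * U s)\<^sup>2"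
      by (simp add: power_mult_distrib power_divide power2_eq_square)
    also have "\<dots> = U s"
      unfolding square r using U_pos[of s] by (simp add: power2_eq_square power3_eq_cube)
    finally show ?thesis .
  qed
  have y_nz: "y s \<noteq> 0" for s using y2[of s] U_pos[of s] by auto
  have y': "(y has_real_derivative y s * (y s - 1) / r) (at s)" for s
  proof -
    have nz: "U s \<noteq> 0" using U_pos[of s] by simp
    have "((\<lambda>s. W s / U s) has_real_derivative
        ((- c * W s - U s * (1 - U s)) * U s - W s * W s) / (U s * U s)) (at s)"
      using U' W' nz by (intro DERIV_divide) auto
    also have "((- c * W s - U s * (1 - U s)) * U s - W s * W s) / (U s * U s)
        = - c * (W s / U s) - (1 - U s) - (W s / U s)\<^sup>2"
      using nz by (simp add: field_simps power2_eq_square)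
    also have "\<dots> = - (5 / 18) * (r * r) * (y s - 1) - 1 + (y s)\<^sup>2 - (r * r) / 9 * (y s - 1)\<^sup>2"
      unfolding W_y y2 cr by (simp add: power_mult_distrib power2_eq_square mult_ac)
    also have "\<dots> = y s * (y s - 1) / 3"
      unfolding r by (simp add: field_simps power2_eq_square)
    finally have "((\<lambda>s. r / 2 * (W s / U s) + 1) has_real_derivative
        r / 2 * (y s * (y s - 1) / 3) + 0) (at s)"
      by (intro DERIV_add DERIV_cmult DERIV_const)
    also have "r / 2 * (y s * (y s - 1) / 3) + 0 = r / 6 * (y s * (y s - 1))"
      by simp
    also have "r / 6 = 1 / r" using r by (simp add: field_simps)
    also have "1 / r * (y s * (y s - 1)) = y s * (y s - 1) / r" by simp
    finally show ?thesis unfolding y_def .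
  qed
  define k where "k = 1 / y 0 - 1"
  have y_eq: "1 / y s = 1 + k * exp (s / r)" for s
  proof -
    have "((\<lambda>s. (1 / y s - 1) * exp (- s / r)) has_real_derivative 0) (at s)" for s
    proof -
      have "((\<lambda>s. (1 / y s - 1) * exp (- s / r)) has_real_derivative
          (- (y s * (y s - 1) / r) / (y s * y s)) * exp (- s / r)
          + (1 / y s - 1) * (exp (- s / r) * (- 1 / r))) (at s)"
        using y_nz r(1) by (auto intro!: derivative_eq_intros y')
      also have "(- (y s * (y s - 1) / r) / (y s * y s)) * exp (- s / r)
          + (1 / y s - 1) * (exp (- s / r) * (- 1 / r)) = 0"
        using y_nz[of s] r(1) by (simp add: field_simps)
      finally show ?thesis .
    qed
    then have "(1 / y s - 1) * exp (- s / r) = (1 / y 0 - 1) * exp (- 0 / r)"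
      using DERIV_isconst_all[of "\<lambda>s. (1 / y s - 1) * exp (- s / r)" s 0] by blast
    then have "1 / y s - 1 = k * exp (s / r)"
      by (simp add: k_def exp_minus field_simps)
    then show ?thesis by simp
  qed
  have U_eq: "U s = 1 / (1 + k * exp (s / r)) ^ 2" for s
    by (metis y_eq y2 power_one_over inverse_eq_divide inverse_inverse_eq)
  have "k > 0"
  proof (rule ccontr)
    assume "\<not> k > 0"
    then consider "k = 0" | "k < 0" by linarith
    then show False
    proof cases
      case 1
      with U_less_1[OF wave, of 0] U_eq show False by simp
    next
      case 2
      \<comment> \<open>For \<open>k < 0\<close> the right-hand side of \<open>y_eq\<close> would vanish somewhere, but \<open>1 / y\<close> does not.\<close>
      then have "1 + k * exp (r * ln (- 1 / k) / r) = 0" using r by (simp add: divide_neg_neg)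
      then show False using y_eq[of "r * ln (- 1 / k)"] y_nz by simp
    qed
  qed
  with U_eq show "\<exists>k>0. \<forall>s. U s = 1 / (1 + k * exp (1 / sqrt 6 * s)) ^ 2"
    by (auto simp: r_def)
qed

end

section \<open>The Explicit Waves\<close>

lemma explicit_profile:
  fixes k :: real
  assumes k: "k > 0"
  defines "U \<equiv> \<lambda>s. 1 / (1 + k * exp (1 / sqrt 6 * s)) ^ 2"
  shows "wave_profile (5 / sqrt 6) U" and "algebraic_profile U"
proof -
  define r where "r = sqrt 6"
  have r: "r > 0" "r * r = 6" by (simp_all add: r_def)
  define E where "E s = k * exp (1 / r * s)" for s
  have E_pos: "E s > 0" for s using k by (simp add: E_def)
  have U: "U = (\<lambda>s. 1 / (1 + E s) ^ 2)" by (simp add: U_def E_def r_def)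
  have E': "(E has_real_derivative E s / r) (at s)" for s
    unfolding E_def using r(1) by (auto intro!: derivative_eq_intros)
  have nz: "1 + E s \<noteq> 0" for s using E_pos[of s] by linarith
  define W where "W s = - 2 * E s / (r * (1 + E s) ^ 3)" for s
  have U': "(U has_real_derivative W s) (at s)" for s
  proof -
    have "(U has_real_derivative - (2 * (1 + E s) * (E s / r)) / ((1 + E s) ^ 2 * (1 + E s) ^ 2)) (at s)"
      unfolding U using nz[of s] by (auto intro!: derivative_eq_intros E')
    also have "- (2 * (1 + E s) * (E s / r)) / ((1 + E s) ^ 2 * (1 + E s) ^ 2) = W s"
      unfolding W_def using nz[of s] r by (simp add: divide_simps power2_eq_square power3_eq_cube)
    finally show ?thesis .
  qed
  have dU: "deriv U = W" using DERIV_imp_deriv[OF U'] by auto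
  have W': "(W has_real_derivative - (5 / r) * W s - U s * (1 - U s)) (at s)" for s
  proof -
    have "(W has_real_derivative (- 2 * (E s / r) * (r * (1 + E s) ^ 3) -
        - 2 * E s * (r * (3 * (1 + E s) ^ 2 * (E s / r)))) / ((r * (1 + E s) ^ 3) * (r * (1 + E s) ^ 3))) (at s)"
      unfolding W_def
    proof (rule DERIV_divide)
      show "((\<lambda>s. - 2 * E s) has_real_derivative - 2 * (E s / r)) (at s)"
        by (intro DERIV_cmult E')
      show "((\<lambda>s. r * (1 + E s) ^ 3) has_real_derivative r * (3 * (1 + E s) ^ 2 * (E s / r))) (at s)"
        by (auto intro!: derivative_eq_intros E')
    qed (use nz[of s] r(1) in simp)
    also have "(- 2 * (E s / r) * (r * (1 + E s) ^ 3) -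
        - 2 * E s * (r * (3 * (1 + E s) ^ 2 * (E s / r)))) / ((r * (1 + E s) ^ 3) * (r * (1 + E s) ^ 3))
        = (4 * (E s)\<^sup>2 - 2 * E s) / ((r * r) * (1 + E s) ^ 4)"
      using nz[of s] r(1) by (simp add: divide_simps) (simp add: algebra_simps eval_nat_numeral)
    also have "\<dots> = 10 * E s / ((r * r) * (1 + E s) ^ 3) - U s * (1 - U s)"
      unfolding r U using nz[of s]
      by (simp add: divide_simps) (simp add: algebra_simps eval_nat_numeral)
    also have "10 * E s / ((r * r) * (1 + E s) ^ 3) = - (5 / r) * W s"
      by (simp add: W_def)
    finally show ?thesis .
  qed
  have "(E \<longlongrightarrow> 0) at_bot"
    unfolding E_def using r(1) by (intro tendsto_mult_right_zero exp_mult_at_bot) simp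
  then have bot: "(U \<longlongrightarrow> 1) at_bot"
    unfolding U by (auto intro!: tendsto_eq_intros)
  have "filterlim E at_top at_top"
    unfolding E_def using r(1) k
    by (intro filterlim_tendsto_pos_mult_at_top[OF tendsto_const]
        filterlim_compose[OF exp_at_top] filterlim_ident) auto
  then have "filterlim (\<lambda>s. (1 + E s) ^ 2) at_top at_top"
    by (intro filterlim_pow_at_top filterlim_tendsto_add_at_top[OF tendsto_const]) auto
  then have top: "(U \<longlongrightarrow> 0) at_top"
    unfolding U by (intro tendsto_divide_0[OF tendsto_const] filterlim_at_top_imp_at_infinity)
  show wave: "wave_profile (5 / sqrt 6) U"
    unfolding wave_profile_def dU r_def[symmetric] using U' W' bot top by simp
  \<comment> \<open>The cuspidal cubic \<open>(3 w + r z)\<^sup>2 - 6 z\<^sup>3\<close>, expanded below with \<open>r\<^sup>2 = 6\<close>.\<close>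
  have "(3 * W s + r * U s)\<^sup>2 = 6 * U s ^ 3" for s
  proof -
    have "3 * W s + r * U s = (r * r * (1 + E s) - 6 * E s) / (r * (1 + E s) ^ 3)"
      unfolding W_def U using nz[of s] r(1) by (simp add: divide_simps power2_eq_square power3_eq_cube)
    also have "\<dots> = 6 / (r * (1 + E s) ^ 3)" unfolding r by simp
    also have "\<dots> ^ 2 = 36 / ((r * r) * (1 + E s) ^ 6)"
      by (simp add: power_divide power_mult_distrib power2_eq_square eval_nat_numeral)
    also have "\<dots> = 6 * U s ^ 3" unfolding r U by (simp add: power_divide flip: power_mult)
    finally show ?thesis .
  qed
  then have "poly2 [:[:0, 0, 6, - 6:], [:0, 6 * r:], [:9:]:] (U s) (deriv U s) = 0" for s
  proof -
    have "poly2 [:[:0, 0, 6, - 6:], [:0, 6 * r:], [:9:]:] (U s) (W s)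
        = (3 * W s + r * U s)\<^sup>2 - (r * r - 6) * (U s)\<^sup>2 - 6 * U s ^ 3"
      by (simp add: power2_eq_square power3_eq_cube algebra_simps)
    then show ?thesis unfolding dU using \<open>(3 * W s + r * U s)\<^sup>2 = 6 * U s ^ 3\<close> r by simp
  qed
  moreover have "[:[:0, 0, 6, - 6:], [:0, 6 * r:], [:9:]:] \<noteq> 0" by simp
  moreover have "\<not> U constant_on UNIV"
  proof
    assume "U constant_on UNIV"
    then obtain a where "U = (\<lambda>_. a)" by (auto simp: constant_on_def)
    then have "deriv U 0 = 0" by simp
    moreover have "W 0 < 0"
      unfolding W_def using E_pos[of 0] r by (intro divide_neg_pos) auto
    ultimately show False by (simp add: dU)
  qed
  ultimately show "algebraic_profile U" unfolding algebraic_profile_def by blast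
qed

lemma wave_profile_solution:
  assumes "wave_profile c U"
  shows "fisher_kolmogorov_solution (\<lambda>x t. U (x - c * t))"
  unfolding fisher_kolmogorov_solution_def
proof (intro exI allI conjI)
  fix x t :: real
  have U': "(U has_real_derivative deriv U s) (at s)"
    and U'': "(deriv U has_real_derivative - c * deriv U s - U s * (1 - U s)) (at s)" for s
    using assms by (simp_all add: wave_profile_def)
  show "((\<lambda>\<tau>. U (x - c * \<tau>)) has_real_derivative deriv U (x - c * t) * (- c)) (at t)"
    by (rule DERIV_chain2[OF U']) (auto intro!: derivative_eq_intros)
  have x: "((\<lambda>\<xi>. \<xi> - c * t) has_real_derivative 1) (at x)"
    by (auto intro!: derivative_eq_intros)
  show "((\<lambda>\<xi>. U (\<xi> - c * t)) has_real_derivative deriv U (x - c * t)) (at x)"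
    using DERIV_chain2[OF U' x] by simp
  show "((\<lambda>\<xi>. deriv U (\<xi> - c * t)) has_real_derivative
      - c * deriv U (x - c * t) - U (x - c * t) * (1 - U (x - c * t))) (at x)"
    using DERIV_chain2[OF U'' x] by simp
  show "deriv U (x - c * t) * (- c) = - c * deriv U (x - c * t) - U (x - c * t) * (1 - U (x - c * t))
      + U (x - c * t) * (1 - U (x - c * t))"
    by simp
qed

theorem theorem1p2:
  shows "(\<forall>(c::real) (u :: real \<Rightarrow> real \<Rightarrow> real). algebraic_traveling_wave c u \<longrightarrow>
            c = 5 / sqrt 6 \<and>
            (\<exists>k>0. \<forall>x t. u x t = 1 / (1 + k * exp (1 / sqrt 6 * (x - 5 / sqrt 6 * t))) ^ 2)) \<and>
         (\<forall>k::real. k > 0 \<longrightarrow>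
            algebraic_traveling_wave (5 / sqrt 6)
              (\<lambda>x t. 1 / (1 + k * exp (1 / sqrt 6 * (x - 5 / sqrt 6 * t))) ^ 2))"
proof (intro conjI allI impI)
  fix c :: real and u :: "real \<Rightarrow> real \<Rightarrow> real"
  assume "algebraic_traveling_wave c u"
  then obtain U P where u: "\<And>x t. u x t = U (x - c * t)" and wave: "wave_profile c U"
      and P: "P \<noteq> 0" "\<And>s. poly2 P (U s) (deriv U s) = 0"
    unfolding algebraic_traveling_wave_def traveling_wave_with_profile_def algebraic_profile_def
    by blast
  show c: "c = 5 / sqrt 6" by (rule algebraic_profile_explicit(1)[OF wave P])
  show "\<exists>k>0. \<forall>x t. u x t = 1 / (1 + k * exp (1 / sqrt 6 * (x - 5 / sqrt 6 * t))) ^ 2"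
    using algebraic_profile_explicit(2)[OF wave P] unfolding u c by metis
next
  fix k :: real assume k: "k > 0"
  show "algebraic_traveling_wave (5 / sqrt 6)
      (\<lambda>x t. 1 / (1 + k * exp (1 / sqrt 6 * (x - 5 / sqrt 6 * t))) ^ 2)"
    unfolding algebraic_traveling_wave_def traveling_wave_with_profile_def
    using explicit_profile[OF k] wave_profile_solution[OF explicit_profile(1)[OF k]]
    by (intro exI[of _ "\<lambda>s. 1 / (1 + k * exp (1 / sqrt 6 * s)) ^ 2"]) simp
qed

end
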